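(* For any $p,m\in\mathbb{N}$ and $k\in\mathbb{N}_0$, $$\sum_{n=p-1}^\infty\left[\frac{\binom{2n}{n}}{4^n}\right]^2\frac{t_n(2_{p-1})\zeta^\star_n(1_k)}{(2n+1)^m}\in\frac{i}{\pi}\mathrm{CMZV}^4_{2p+k+m-1}.$$
   Context: $i=\sqrt{-1}$. $t_n(2_{p-1})=\sum_{n\ge n_1>\cdots>n_{p-1}>0}\prod_j(2n_j-1)^{-2}$ and $\zeta^\star_n(1_k)=\sum_{n\ge n_1\ge\cdots\ge n_k>0}\prod_j n_j^{-1}$, each equal to $1$ for the empty string. $\mathrm{CMZV}^4_w$ is the $\mathbb{Q}$-span of colored multiple zeta values $\sum_{n_1>\cdots>n_s>0}\prod_j z_j^{n_j}n_j^{-a_j}$ of weight $w$ with all $z_j$ fourth roots of unity and $(a_1,z_1)\ne(1,1)$; $\frac{i}{\pi}\mathrm{CMZV}^4_w=\{\frac{i}{\pi}x:x\in\mathrm{CMZV}^4_w\}$. *)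

theory Defs
  imports "HOL-Analysis.Analysis"
begin

text \<open>Multiple t-harmonic sums: \<open>n \<ge> n\<^sub>1 > \<dots> > n\<^sub>r > 0\<close>. The index string and the summation
  tuple are lists of the same length, so the empty string yields the one-term sum 1.\<close>

definition t_sum :: "nat \<Rightarrow> nat list \<Rightarrow> real" where
  "t_sum n as =
    (\<Sum>ns | length ns = length as \<and> set ns \<subseteq> {1..n} \<and> sorted_wrt (>) ns.
      \<Prod>j<length as. 1 / (2 * real (ns ! j) - 1) ^ (as ! j))"

definition zeta_star_sum :: "nat \<Rightarrow> nat list \<Rightarrow> real" where
  "zeta_star_sum n as =
    (\<Sum>ns | length ns = length as \<and> set ns \<subseteq> {1..n} \<and> sorted_wrt (\<ge>) ns.
      \<Prod>j<length as. 1 / real (ns ! j) ^ (as ! j))"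

text \<open>A colored multiple zeta value is specified by the list of pairs \<open>(a\<^sub>j, z\<^sub>j)\<close>. When
  \<open>a\<^sub>1 = 1\<close> the series converges only conditionally; its value is the limit of the partial
  sums over \<open>N \<ge> n\<^sub>1 > \<dots> > n\<^sub>s > 0\<close>.\<close>

definition colored_sum :: "nat \<Rightarrow> (nat \<times> complex) list \<Rightarrow> complex" where
  "colored_sum N azs =
    (\<Sum>ns | length ns = length azs \<and> set ns \<subseteq> {1..N} \<and> sorted_wrt (>) ns.
      \<Prod>j<length azs. snd (azs ! j) ^ (ns ! j) / of_nat (ns ! j) ^ fst (azs ! j))"

definition colored_mzv :: "(nat \<times> complex) list \<Rightarrow> complex" where
  "colored_mzv azs = lim (\<lambda>N. colored_sum N azs)"

definition admissible :: "nat \<Rightarrow> (nat \<times> complex) list \<Rightarrow> bool" where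
  "admissible N azs \<longleftrightarrow>
    (\<forall>(a, z) \<in> set azs. a \<ge> 1 \<and> z ^ N = 1) \<and> (azs \<noteq> [] \<longrightarrow> hd azs \<noteq> (1, 1))"

definition weight :: "(nat \<times> complex) list \<Rightarrow> nat" where
  "weight azs = sum_list (map fst azs)"

global_interpretation rat_complex: vector_space "\<lambda>(q::rat) (z::complex). of_rat q * z"
  defines rat_span = rat_complex.span
  by unfold_locales (simp_all add: of_rat_add of_rat_mult algebra_simps)

definition CMZV :: "nat \<Rightarrow> nat \<Rightarrow> complex set" where
  "CMZV N w = rat_span {colored_mzv azs | azs. admissible N azs \<and> weight azs = w}"

end

theory Submission imports Defs
begin

text \<open>
  Write \<open>b\<^sub>n = binom(2n, n) / 4^n\<close> and \<open>\<lambda> = - ln (cos x)^2\<close>. Integration by parts shows that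
  \<open>sin^(2n) x \<lambda>^j / j!\<close> integrates over \<open>[0, \<pi>/2]\<close> to
  \<open>\<Sum>i\<le>j. I\<^sub>i b\<^sub>n \<zeta>\<^sup>\<star>\<^sub>n(1\<^sub>j\<^sub>-\<^sub>i)\<close>, where \<open>I\<^sub>i\<close> is the integral of \<open>\<lambda>^i / i!\<close> and
  \<open>I\<^sub>0 = \<pi>/2\<close>. Summing over \<open>n\<close> against \<open>b\<^sub>n t\<^sub>n(2\<^sub>p\<^sub>-\<^sub>1) / (2n+1)^m\<close>, whose generating function is
  obtained from \<open>x^(2p-1) / (2p-1)!\<close> by \<open>m - 1\<close> integrations against \<open>cot x dx\<close>, yields a triangular
  system for the sums in question. In the variable \<open>t = tan (x/2)\<close> all integrands become
  polylogarithms with letters \<open>0\<close> and the fourth roots of unity, so that the integrals are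
  values of such polylogarithms at 1, that is, colored multiple zeta values of level 4, and these
  are closed under multiplication by the shuffle product. Finally, the expansion of \<open>\<lambda>\<close> in powers
  of \<open>sin x\<close> gives \<open>j I\<^sub>j = \<Sum> I\<^sub>i E\<^sub>k\<close> (over \<open>i + k = j - 1\<close>) with \<open>E\<^sub>k = \<Sum>n. b\<^sub>n \<zeta>\<^sup>\<star>\<^sub>n(1\<^sub>k) / n\<close>
  of weight \<open>k + 1\<close>, so that \<open>I\<^sub>j / I\<^sub>0\<close> has weight \<open>j\<close> and the system can be solved.
\<close>


section \<open>Nested sums\<close>

text \<open>The obstacle is the division by \<open>pi\<close>. The diagonal of the triangular system
  is I_0 = pi/2, and integrating \<lambda>^j / j! against dx directly shows only that \<i> I_j has
  weight j + 1, a value from which \<open>pi\<close> cannot be cancelled. The detour through E_k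
  succeeds because E_k is an integral against 2 tan (x/2) dx, in which neither \<i> nor
  \<open>pi\<close> occurs. The factor \<i> of the theorem stems from \<i> dx being the difference
  of the forms with letters \<i> and -\<i>: the odd power of x brings an odd power of \<i>, so that
  \<i> \<open>pi\<close> times the sum is what has weight 2p + k + m - 1. The other delicate point
  is x = pi/2, that is t = 1, where \<lambda> diverges and the letter 1 occurs. The outermost form
  of every integral is dt/t or has letter \<i> or -\<i>, so the integrals converge and the indices
  are admissible. The series at 1 may still converge only conditionally, which is why values at 1
  are treated as limits from the left.\<close>

definition nested_sum :: "(nat \<Rightarrow> nat \<Rightarrow> bool) \<Rightarrow> nat \<Rightarrow> nat \<Rightarrow> (nat \<Rightarrow> nat \<Rightarrow> 'a::comm_ring_1) \<Rightarrow> 'a" where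
  "nested_sum R N l F =
    (\<Sum>ns | length ns = l \<and> set ns \<subseteq> {1..N} \<and> sorted_wrt R ns. \<Prod>j<l. F j (ns ! j))"

lemma nested_sum_0: "nested_sum R N 0 F = 1"
proof -
  have "{ns::nat list. length ns = 0 \<and> set ns \<subseteq> {1..N} \<and> sorted_wrt R ns} = {[]}" by auto
  then show ?thesis by (simp add: nested_sum_def)
qed

text \<open>\<open>M n\<close> is the bound that \<open>R\<close> leaves for the remaining indices
  once the outermost one is \<open>n\<close>: \<open>n - 1\<close> for strict decrease,
  \<open>n\<close> for weak decrease. One recursion thus serves all three kinds of sums.\<close>

lemma nested_sum_Suc:
  assumes "\<And>n. n \<in> {1..N} \<Longrightarrow> {m\<in>{1..N}. R n m} = {1..M n}"
  shows "nested_sum R N (Suc l) F = (\<Sum>n=1..N. F 0 n * nested_sum R (M n) l (\<lambda>j. F (Suc j)))"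
proof -
  define A where "A = (\<lambda>l N. {ns. length ns = l \<and> set ns \<subseteq> {1..N} \<and> sorted_wrt R ns})"
  have fin: "finite (A l N)" for l N
    by (rule finite_subset[OF _ finite_lists_length_eq[of "{1..N}" l]]) (auto simp: A_def)
  have sub: "set ns \<subseteq> {1..N} \<and> (\<forall>m\<in>set ns. R n m) \<longleftrightarrow> set ns \<subseteq> {1..M n}" if "n \<in> {1..N}" for n ns
    using assms[OF that] by blast
  have A: "A (Suc l) N = (\<lambda>(n, ns). n # ns) ` (SIGMA n:{1..N}. A l (M n))" (is "_ = ?B")
  proof (rule set_eqI)
    fix xs
    show "xs \<in> A (Suc l) N \<longleftrightarrow> xs \<in> ?B"
    proof (cases xs)
      case (Cons n ns)
      have "xs \<in> A (Suc l) N \<longleftrightarrow> n \<in> {1..N} \<and> length ns = l \<and> sorted_wrt R ns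
            \<and> (set ns \<subseteq> {1..N} \<and> (\<forall>m\<in>set ns. R n m))"
        by (auto simp: A_def Cons)
      also have "\<dots> \<longleftrightarrow> n \<in> {1..N} \<and> ns \<in> A l (M n)"
        using sub[of n ns] unfolding A_def by blast
      finally show ?thesis by (auto simp: Cons)
    qed (auto simp: A_def)
  qed
  have "nested_sum R N (Suc l) F = (\<Sum>ns\<in>A (Suc l) N. \<Prod>j<Suc l. F j (ns ! j))"
    by (simp add: nested_sum_def A_def)
  also have "\<dots> = (\<Sum>(n, ns)\<in>(SIGMA n:{1..N}. A l (M n)). F 0 n * (\<Prod>j<l. F (Suc j) (ns ! j)))"
    unfolding A
    by (subst sum.reindex) (auto simp: inj_on_def prod.lessThan_Suc_shift simp del: prod.lessThan_Suc intro!: sum.cong)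
  also have "\<dots> = (\<Sum>n=1..N. \<Sum>ns\<in>A l (M n). F 0 n * (\<Prod>j<l. F (Suc j) (ns ! j)))"
    by (rule sum.Sigma[symmetric]) (auto simp: fin)
  also have "\<dots> = (\<Sum>n=1..N. F 0 n * nested_sum R (M n) l (\<lambda>j. F (Suc j)))"
    by (simp add: sum_distrib_left nested_sum_def A_def)
  finally show ?thesis .
qed

lemma colored_sum_Nil [simp]: "colored_sum N [] = 1"
  using nested_sum_0[of "(>)" N "\<lambda>_ _. 1 :: complex"] by (simp add: colored_sum_def nested_sum_def)

lemma colored_sum_Cons:
  "colored_sum N ((a, z) # azs) = (\<Sum>n=1..N. z ^ n / of_nat n ^ a * colored_sum (n - 1) azs)"
proof -
  have "colored_sum N azs = nested_sum (>) N (length azs)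
          (\<lambda>j n. snd (azs ! j) ^ n / of_nat n ^ fst (azs ! j))" for N azs
    by (simp add: colored_sum_def nested_sum_def)
  moreover have "{m \<in> {1..N}. m < n} = {1..n - 1}" if "n \<in> {1..N}" for n
    using that by auto
  ultimately show ?thesis
    using nested_sum_Suc[of N "(>)" "\<lambda>n. n - 1" "length azs"
        "\<lambda>j n. snd (((a, z) # azs) ! j) ^ n / of_nat n ^ fst (((a, z) # azs) ! j)"]
    by simp
qed

lemma colored_sum_0_Cons [simp]: "colored_sum 0 (x # azs) = 0"
  by (cases x) (simp add: colored_sum_Cons)

lemma colored_sum_Suc_Cons:
  "colored_sum (Suc N) ((a, z) # azs) =
     colored_sum N ((a, z) # azs) + z ^ Suc N / of_nat (Suc N) ^ a * colored_sum N azs"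
  by (simp add: colored_sum_Cons)

lemma t_sum_Nil [simp]: "t_sum N [] = 1"
  using nested_sum_0[of "(>)" N "\<lambda>_ _. 1 :: real"] by (simp add: t_sum_def nested_sum_def)

lemma t_sum_Cons:
  "t_sum N (a # as) = (\<Sum>n=1..N. 1 / (2 * real n - 1) ^ a * t_sum (n - 1) as)"
proof -
  have "t_sum N as = nested_sum (>) N (length as) (\<lambda>j n. 1 / (2 * real n - 1) ^ (as ! j))" for N as
    by (simp add: t_sum_def nested_sum_def)
  moreover have "{m \<in> {1..N}. m < n} = {1..n - 1}" if "n \<in> {1..N}" for n
    using that by auto
  ultimately show ?thesis
    using nested_sum_Suc[of N "(>)" "\<lambda>n. n - 1" "length as"
        "\<lambda>j n. 1 / (2 * real n - 1) ^ ((a # as) ! j)"]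
    by simp
qed

lemma t_sum_0_Cons [simp]: "t_sum 0 (a # as) = 0"
  by (simp add: t_sum_Cons)

lemma t_sum_Suc_Cons:
  "t_sum (Suc N) (a # as) = t_sum N (a # as) + t_sum N as / (2 * real N + 1) ^ a"
  by (simp add: t_sum_Cons add.commute)

lemma t_sum_nonneg: "t_sum n as \<ge> 0"
proof (induction as arbitrary: n)
  case (Cons a as)
  then show ?case by (induction n) (auto simp: t_sum_Suc_Cons)
qed simp

text \<open>No strictly decreasing tuple fits. This turns the sum over n \<ge> p - 1 into a sum over
  all n.\<close>

lemma t_sum_eq_0: "n < length as \<Longrightarrow> t_sum n as = 0"
proof (induction as arbitrary: n)
  case (Cons a as)
  then show ?case by (induction n) (auto simp: t_sum_Suc_Cons)
qed simp

text \<open>Crude, but polynomial growth suffices for the radius of convergence of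
  \<open>gser\<close>.\<close>

lemma t_sum_le:
  "t_sum n as \<le> real (Suc n) ^ length as"
proof (induction as arbitrary: n)
  case (Cons a as n)
  show ?case
  proof (induction n)
    case (Suc n)
    have "t_sum n as / (2 * real n + 1) ^ a \<le> t_sum n as"
      using t_sum_nonneg[of n as] by (simp add: divide_le_eq mult_le_cancel_left1 )
    also have "\<dots> \<le> real (Suc n) ^ length as" by (rule Cons)
    finally have "t_sum (Suc n) (a # as) \<le> real (Suc n) * real (Suc n) ^ length as + real (Suc n) ^ length as"
      using Suc by (simp add: t_sum_Suc_Cons)
    also have "\<dots> = real (Suc (Suc n)) * real (Suc n) ^ length as" by (simp add: algebra_simps)
    also have "\<dots> \<le> real (Suc (Suc n)) * real (Suc (Suc n)) ^ length as"
      by (intro mult_left_mono power_mono) auto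
    finally show ?case by simp
  qed simp
qed simp

lemma zeta_star_sum_Nil [simp]: "zeta_star_sum N [] = 1"
  using nested_sum_0[of "(\<ge>)" N "\<lambda>_ _. 1 :: real"] by (simp add: zeta_star_sum_def nested_sum_def)

lemma zeta_star_sum_Cons:
  "zeta_star_sum N (a # as) = (\<Sum>n=1..N. 1 / real n ^ a * zeta_star_sum n as)"
proof -
  have "zeta_star_sum N as = nested_sum (\<ge>) N (length as) (\<lambda>j n. 1 / real n ^ (as ! j))" for N as
    by (simp add: zeta_star_sum_def nested_sum_def)
  moreover have "{m \<in> {1..N}. m \<le> n} = {1..n}" if "n \<in> {1..N}" for n
    using that by auto
  ultimately show ?thesis
    using nested_sum_Suc[of N "(\<ge>)" "\<lambda>n. n" "length as" "\<lambda>j n. 1 / real n ^ ((a # as) ! j)"]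
    by simp
qed

lemma zeta_star_sum_0_Cons [simp]: "zeta_star_sum 0 (a # as) = 0"
  by (simp add: zeta_star_sum_Cons)

lemma zeta_star_sum_Suc_Cons:
  "zeta_star_sum (Suc N) (a # as) =
     zeta_star_sum N (a # as) + zeta_star_sum (Suc N) as / real (Suc N) ^ a"
  by (simp add: zeta_star_sum_Cons)

lemma zeta_star_sum_nonneg: "zeta_star_sum n as \<ge> 0"
proof (induction as arbitrary: n)
  case (Cons a as)
  then show ?case by (induction n) (auto simp: zeta_star_sum_Suc_Cons)
qed simp

section \<open>Convergence of admissible colored sums\<close>

definition unit_index :: "(nat \<times> complex) list \<Rightarrow> bool" where
  "unit_index azs \<longleftrightarrow> (\<forall>(a, z) \<in> set azs. a \<ge> 1 \<and> norm z = 1)"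

text \<open>Each index contributes at most a factor \<open>harm n\<close>, because its exponent is
  at least 1 and its color has modulus 1.\<close>

lemma norm_colored_sum_le:
  assumes "unit_index azs"
  shows "norm (colored_sum n azs) \<le> harm n ^ length azs"
  using assms
proof (induction azs arbitrary: n)
  case (Cons x azs n)
  obtain a z where x: "x = (a, z)" by force
  have az: "a \<ge> 1" "norm z = 1" "unit_index azs" using Cons.prems by (auto simp: unit_index_def x)
  show ?case
  proof (induction n)
    case (Suc n)
    have "norm (z ^ Suc n / of_nat (Suc n) ^ a * colored_sum n azs)
          = norm (colored_sum n azs) / real (Suc n) ^ a"
      by (simp only: norm_mult norm_divide norm_power az norm_of_nat) simp
    also have "\<dots> \<le> norm (colored_sum n azs) / real (Suc n) ^ 1"
      using az(1) by (intro divide_left_mono power_increasing) auto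
    also have "\<dots> \<le> harm n ^ length azs / real (Suc n)"
      using Cons.IH[OF az(3)] by (simp add: divide_right_mono)
    finally have "norm (colored_sum (Suc n) (x # azs))
        \<le> harm n ^ Suc (length azs) + harm n ^ length azs / real (Suc n)"
      using Suc norm_triangle_ineq[of "colored_sum n ((a, z) # azs)"
          "z ^ Suc n / of_nat (Suc n) ^ a * colored_sum n azs"]
      unfolding x colored_sum_Suc_Cons by simp
    also have "\<dots> = harm (Suc n) * harm n ^ length azs"
      by (simp add: harm_Suc field_simps)
    also have "\<dots> \<le> harm (Suc n) * harm (Suc n) ^ length azs"
      by (intro mult_left_mono power_mono harm_mono harm_nonneg) auto
    finally show ?case by simp
  qed (simp add: x harm_def)
qed simp

text \<open>Harmonic numbers grow logarithmically. The square root is one bound for every depth: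
  divided by n it tends to 0, divided by n^2 it is summable.\<close>

lemma harm_power_le_sqrt: "\<exists>C. \<forall>n. harm n ^ k \<le> C * sqrt (real n + 1)"
proof (cases "k = 0")
  case False
  \<comment> \<open>With this exponent, (n^s)^k is the square root of n.\<close>
  define s where "s = 1 / (2 * real k)"
  have s: "s > 0" using False by (simp add: s_def)
  have "(\<lambda>n. ln (real n) / real n powr s) \<longlonglongrightarrow> 0" by (rule lim_ln_over_power[OF s])
  from convergent_imp_Bseq[OF convergentI[OF this]]
  obtain B where B: "B > 0" "\<And>n. \<bar>ln (real n) / real n powr s\<bar> \<le> B"
    by (auto simp: Bseq_def)
  have "harm n ^ k \<le> (B + 1) ^ k * sqrt (real n + 1)" for n
  proof -
    have "harm n \<le> (harm (Suc n) :: real)" by (rule harm_mono) simp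
    also have "\<dots> \<le> ln (real (Suc n)) + 1"
      using euler_mascheroni_sequence_decreasing[of 1 "Suc n"] by (simp add: harm_expand)
    also have "ln (real (Suc n)) \<le> B * real (Suc n) powr s"
      using B(2)[of "Suc n"] by (simp add: field_simps abs_le_iff)
    also have "1 \<le> real (Suc n) powr s" using s by (intro ge_one_powr_ge_zero) auto
    finally have "harm n \<le> (B + 1) * real (Suc n) powr s" by (simp add: algebra_simps)
    then have "harm n ^ k \<le> ((B + 1) * real (Suc n) powr s) ^ k"
      by (intro power_mono harm_nonneg)
    also have "\<dots> = (B + 1) ^ k * (real (Suc n) powr s) ^ k" by (simp add: power_mult_distrib)
    also have "(real (Suc n) powr s) ^ k = real (Suc n) powr (1 / 2)"
      using False by (simp add: powr_power s_def)
    also have "\<dots> = sqrt (real n + 1)" by (simp add: powr_half_sqrt add.commute)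
    finally show ?thesis .
  qed
  then show ?thesis by blast
qed (auto intro!: exI[of _ 1])


lemma colored_sum_le_sqrt:
  assumes "unit_index azs"
  obtains C where "C \<ge> 0" "\<And>n. norm (colored_sum n azs) \<le> C * sqrt (real n + 1)"
proof -
  obtain C where C: "\<And>n. harm n ^ length azs \<le> C * sqrt (real n + 1)"
    using harm_power_le_sqrt by blast
  have le: "norm (colored_sum n azs) \<le> C * sqrt (real n + 1)" for n
    using norm_colored_sum_le[OF assms, of n] C[of n] by linarith
  have "C \<ge> 0"
    using le[of 0] norm_ge_zero[of "colored_sum 0 azs"] by (simp del: norm_ge_zero)
  with le show ?thesis using that by blast
qed

lemma colored_sum_diff_le:
  assumes "unit_index azs"
  obtains C where "C \<ge> 0"
    "\<And>n. norm (colored_sum (Suc n) azs - colored_sum n azs) \<le> C * sqrt (real n + 1) / (real n + 1)"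
proof (cases azs)
  case (Cons x r)
  obtain a z where x: "x = (a, z)" by force
  have az: "a \<ge> 1" "norm z = 1" "unit_index r" using assms by (auto simp: unit_index_def x Cons)
  obtain C where C: "C \<ge> 0" "\<And>n. norm (colored_sum n r) \<le> C * sqrt (real n + 1)"
    using colored_sum_le_sqrt[OF az(3)] by blast
  have "norm (colored_sum (Suc n) azs - colored_sum n azs) \<le> C * sqrt (real n + 1) / (real n + 1)" for n
  proof -
    have "norm (colored_sum (Suc n) azs - colored_sum n azs) = norm (colored_sum n r) / real (Suc n) ^ a"
      unfolding Cons x colored_sum_Suc_Cons
      by (simp only: add_diff_cancel_left' norm_mult norm_divide norm_power az norm_of_nat) simp
    also have "\<dots> \<le> norm (colored_sum n r) / real (Suc n) ^ 1"
      using az(1) by (intro divide_left_mono power_increasing) auto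
    also have "\<dots> \<le> C * sqrt (real n + 1) / (real n + 1)"
      using C(2)[of n] by (simp add: divide_right_mono add.commute)
    finally show ?thesis .
  qed
  then show ?thesis using that C(1) by blast
qed (use that[of 0] in simp)

lemma summable_sqrt_over_square: "summable (\<lambda>n. sqrt (real n + 1) / (real n + 1) ^ 2)"
proof -
  have "summable (\<lambda>n. real (Suc n) powr (- 3 / 2))"
    by (subst summable_Suc_iff) (simp add: summable_real_powr_iff)
  then have "summable (\<lambda>n. (real n + 1) powr (- 3 / 2))"
    by (simp only: of_nat_Suc add.commute)
  moreover have "(real n + 1) powr (- 3 / 2) = sqrt (real n + 1) / (real n + 1) ^ 2" for n
  proof -
    define x where "x = real n + 1"
    have "x > 0" by (simp add: x_def add_pos_nonneg)
    have "x powr (- 3 / 2) = x powr (1 / 2) * x powr (- 2)"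
      by (simp flip: powr_add)
    also have "x powr (1 / 2) = sqrt x" using \<open>x > 0\<close> by (simp add: powr_half_sqrt)
    also have "x powr (- 2) = inverse (x ^ 2)" using \<open>x > 0\<close> by (simp add: powr_minus)
    finally show ?thesis unfolding x_def divide_inverse .
  qed
  ultimately show ?thesis by (simp only:)
qed

text \<open>Dirichlet's test, by summation by parts: \<open>1 - z\<close> times the partial sum telescopes.\<close>

lemma convergent_sum_power_mult:
  fixes z :: complex and u :: "nat \<Rightarrow> complex"
  assumes "norm z = 1" "z \<noteq> 1" "u \<longlonglongrightarrow> 0" "summable (\<lambda>n. norm (u (Suc n) - u n))"
  shows "convergent (\<lambda>N. \<Sum>n<N. z ^ n * u n)"
proof -
  have "(1 - z) * (\<Sum>n<N. z ^ n * u n) =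
      u 0 + (\<Sum>n<N. z ^ Suc n * (u (Suc n) - u n)) - z ^ N * u N" for N
  proof (induction N)
    case (Suc N)
    have "(u 0 + A - z ^ N * u N) + (1 - z) * (z ^ N * u N)
        = u 0 + (A + z * z ^ N * (u (Suc N) - u N)) - z * z ^ N * u (Suc N)" for A
      by (simp add: algebra_simps)
    then show ?case
      unfolding sum.lessThan_Suc power_Suc distrib_left[of "1 - z"] Suc[unfolded power_Suc] by simp
  qed simp
  then have eq: "(\<Sum>n<N. z ^ n * u n) =
      (u 0 + (\<Sum>n<N. z ^ Suc n * (u (Suc n) - u n)) - z ^ N * u N) / (1 - z)" for N
    using assms(2) by (simp add: eq_divide_eq mult.commute)
  have "summable (\<lambda>n. norm (z ^ Suc n * (u (Suc n) - u n)))"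
    using assms(4) by (simp add: norm_mult norm_power assms(1))
  then have "summable (\<lambda>n. z ^ Suc n * (u (Suc n) - u n))" by (rule summable_norm_cancel)
  then have 1: "convergent (\<lambda>N. \<Sum>n<N. z ^ Suc n * (u (Suc n) - u n))"
    by (simp add: summable_iff_convergent)
  have "(\<lambda>N. norm (z ^ N * u N)) \<longlonglongrightarrow> 0"
    using tendsto_norm_zero[OF assms(3)] by (simp add: norm_mult norm_power assms(1))
  from tendsto_norm_zero_cancel[OF this] have 2: "convergent (\<lambda>N. z ^ N * u N)"
    by (rule convergentI)
  show ?thesis
    unfolding eq divide_inverse
    by (intro convergent_mult convergent_diff convergent_add convergent_const 1 2)
qed

text \<open>The outermost color decides: if it is 1, the exponent is at least 2 and the series
  converges absolutely; otherwise Dirichlet's test applies.\<close>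

lemma convergent_colored_sum:
  assumes "unit_index azs" "azs \<noteq> [] \<longrightarrow> hd azs \<noteq> (1, 1)"
  shows "convergent (\<lambda>N. colored_sum N azs)"
proof (cases azs)
  case (Cons x r)
  obtain a z where x: "x = (a, z)" by force
  have az: "a \<ge> 1" "norm z = 1" "unit_index r" "(a, z) \<noteq> (1, 1)"
    using assms by (auto simp: unit_index_def x Cons)
  obtain C where C: "C \<ge> 0" "\<And>n. norm (colored_sum n r) \<le> C * sqrt (real n + 1)"
    using colored_sum_le_sqrt[OF az(3)] by blast
  obtain D where D: "D \<ge> 0"
    "\<And>n. norm (colored_sum (Suc n) r - colored_sum n r) \<le> D * sqrt (real n + 1) / (real n + 1)"
    using colored_sum_diff_le[OF az(3)] by blast
  \<comment> \<open>The outermost index n + 1 gives the term z^n * u n; the shift moves the sum to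
    the range n < N of the test.\<close>
  define u where "u = (\<lambda>n. z * colored_sum n r / of_nat (Suc n) ^ a)"
  have nu: "norm (u n) = norm (colored_sum n r) / (real n + 1) ^ a" for n
    unfolding u_def
    by (simp only: norm_mult norm_divide norm_power az norm_of_nat) (simp add: add.commute)
  have eq: "colored_sum N azs = (\<Sum>n<N. z ^ n * u n)" for N
    by (induction N) (simp_all add: Cons x colored_sum_Suc_Cons u_def mult_ac)
  show ?thesis
  proof (cases "z = 1")
    case True
    then have "a \<ge> 2" using az by (cases "a = 1") auto
    have "norm (z ^ n * u n) \<le> C * (sqrt (real n + 1) / (real n + 1) ^ 2)" for n
    proof -
      have "norm (z ^ n * u n) = norm (colored_sum n r) / (real n + 1) ^ a"
        by (simp add: nu norm_mult norm_power az)
      also have "\<dots> \<le> norm (colored_sum n r) / (real n + 1) ^ 2"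
        using \<open>a \<ge> 2\<close> by (intro divide_left_mono power_increasing) auto
      also have "\<dots> \<le> C * sqrt (real n + 1) / (real n + 1) ^ 2"
        using C(2)[of n] by (simp add: divide_right_mono)
      finally show ?thesis by simp
    qed
    then have "summable (\<lambda>n. z ^ n * u n)"
      by (intro summable_comparison_test[OF _ summable_mult[OF summable_sqrt_over_square]]) blast
    then show ?thesis unfolding eq by (simp add: summable_iff_convergent)
  next
    case False
    have "u \<longlonglongrightarrow> 0"
    proof (rule Lim_null_comparison)
      show "\<forall>\<^sub>F n in sequentially. norm (u n) \<le> C * (1 / sqrt (real n + 1))"
      proof (intro always_eventually allI)
        fix n
        have "norm (u n) \<le> norm (colored_sum n r) / (real n + 1) ^ 1"
          unfolding nu using az(1) by (intro divide_left_mono power_increasing) auto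
        also have "\<dots> \<le> C * sqrt (real n + 1) / (real n + 1)"
          using C(2)[of n] by (simp add: divide_right_mono)
        also have "\<dots> = C * (1 / sqrt (real n + 1))"
          using sqrt_divide_self_eq[of "real n + 1"] by (simp add: divide_inverse mult.assoc)
        finally show "norm (u n) \<le> C * (1 / sqrt (real n + 1))" .
      qed
      have "filterlim (\<lambda>n. sqrt (real (Suc n))) at_top sequentially"
        by (intro filterlim_compose[OF sqrt_at_top] filterlim_compose[OF filterlim_real_sequentially]
            filterlim_Suc)
      then have "(\<lambda>n. C * (1 / sqrt (real (Suc n)))) \<longlonglongrightarrow> C * 0"
        by (intro tendsto_mult tendsto_const tendsto_divide_0[OF tendsto_const]
              filterlim_mono[OF _ at_top_le_at_infinity order_refl])
      then show "(\<lambda>n. C * (1 / sqrt (real n + 1))) \<longlonglongrightarrow> 0" by (simp add: add.commute)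
    qed
    moreover have "summable (\<lambda>n. norm (u (Suc n) - u n))"
    proof (cases "a = 1")
      case True
      have "norm (u (Suc n) - u n) \<le> (C + D) * (sqrt (real n + 1) / (real n + 1) ^ 2)" for n
      proof -
        define d where "d = colored_sum (Suc n) r - colored_sum n r"
        define A B :: complex where "A = of_nat (Suc n)" and "B = of_nat (Suc (Suc n))"
        have "A \<noteq> 0" "B \<noteq> 0" unfolding A_def B_def of_nat_eq_0_iff by simp_all
        moreover have "B = A + 1" by (simp add: A_def B_def)
        \<comment> \<open>Partial fractions exhibit the cancellation between consecutive terms: u n
          alone is only bounded by sqrt n / n, the difference by sqrt n / n^2.\<close>
        ultimately have "c / A = c / B + c / (A * B)" for c
        proof -
          have "c / B + c / (A * B) = c * (A + 1) / (A * B)"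
            using \<open>A \<noteq> 0\<close> by (simp add: distrib_left add_divide_distrib)
          also have "\<dots> = c / A"
            unfolding \<open>B = A + 1\<close>[symmetric] using \<open>B \<noteq> 0\<close> by simp
          finally show ?thesis by simp
        qed
        then have "z * colored_sum n r / A = z * colored_sum n r / B + z * colored_sum n r / (A * B)" .
        then have "u (Suc n) - u n = z * (d / B - colored_sum n r / (A * B))"
          unfolding u_def d_def True power_one_right A_def[symmetric] B_def[symmetric]
          by (simp only: right_diff_distrib distrib_left diff_divide_distrib times_divide_eq_right diff_diff_eq)
        then have "norm (u (Suc n) - u n) = norm (d / B - colored_sum n r / (A * B))"
          by (simp only: norm_mult az mult_1_left)
        also have "\<dots> \<le> norm (d / B) + norm (colored_sum n r / (A * B))"
          by (rule norm_triangle_ineq4)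
        also have "\<dots> = norm d / real (Suc (Suc n)) + norm (colored_sum n r) / (real (Suc n) * real (Suc (Suc n)))"
          by (simp only: A_def B_def norm_divide norm_mult norm_of_nat)
        also have "\<dots> \<le> norm d / real (Suc n) + norm (colored_sum n r) / (real (Suc n) * real (Suc n))"
          by (intro add_mono divide_left_mono mult_left_mono) auto
        also have "\<dots> \<le> (D * sqrt (real n + 1) / (real n + 1)) / real (Suc n)
              + (C * sqrt (real n + 1)) / (real (Suc n) * real (Suc n))"
          using C(2)[of n] D(2)[of n] by (intro add_mono divide_right_mono) (auto simp: d_def)
        also have "\<dots> = (C + D) * (sqrt (real n + 1) / (real n + 1) ^ 2)"
          by (simp only: of_nat_Suc power2_eq_square add.commute[of 1] add_divide_distrib
              distrib_right divide_divide_eq_left times_divide_eq_right add.commute[of "C * _ / _"])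
        finally show ?thesis .
      qed
      then show ?thesis
        by (intro summable_comparison_test[OF _ summable_mult[OF summable_sqrt_over_square]])
          (simp, blast)
    next
      case False
      have le: "norm (u n) \<le> C * (sqrt (real n + 1) / (real n + 1) ^ 2)" for n
      proof -
        have "norm (u n) \<le> norm (colored_sum n r) / (real n + 1) ^ 2"
          unfolding nu using False az(1) by (intro divide_left_mono power_increasing) auto
        also have "\<dots> \<le> C * sqrt (real n + 1) / (real n + 1) ^ 2"
          using C(2)[of n] by (simp add: divide_right_mono)
        finally show ?thesis by simp
      qed
      have "summable (\<lambda>n. norm (u n))"
        using le by (intro summable_comparison_test[OF _ summable_mult[OF summable_sqrt_over_square]]) auto
      then have "summable (\<lambda>n. norm (u (Suc n)) + norm (u n))"
        by (intro summable_add) (simp_all add: summable_Suc_iff[of "\<lambda>n. norm (u n)"])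
      then show ?thesis
        by (rule summable_comparison_test[rotated]) (auto intro: norm_triangle_ineq4)
    qed
    ultimately show ?thesis
      unfolding eq by (intro convergent_sum_power_mult az False)
  qed
qed (simp add: convergent_const)


section \<open>Multiple polylogarithms as power series\<close>

text \<open>\<open>pint z\<close> integrates from 0 against \<open>dx/x\<close> if \<open>z = 0\<close>, and against \<open>z dx / (1 - z x)\<close>
  otherwise. For \<open>z = 0\<close> it needs a vanishing constant term, which the junk value \<open>c / 0 = 0\<close>
  silently drops.\<close>

definition letter :: "complex \<Rightarrow> complex fps" where
  "letter z = Abs_fps (\<lambda>n. if n = 0 \<and> z \<noteq> 0 then 0 else z ^ n)"

definition pint :: "complex \<Rightarrow> complex fps \<Rightarrow> complex fps" where
  "pint z f = Abs_fps (\<lambda>n. fps_nth (letter z * f) n / of_nat n)"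

lemma letter_nth_0: "z \<noteq> 0 \<Longrightarrow> fps_nth (letter z) 0 = 0"
  by (simp add: letter_def)

lemma letter_0 [simp]: "letter 0 = 1"
  by (rule fps_ext) (simp add: letter_def)

lemma pint_nth_0 [simp]: "fps_nth (pint z f) 0 = 0"
  by (simp add: pint_def)

lemma XD_pint:
  assumes "z \<noteq> 0 \<or> fps_nth f 0 = 0"
  shows "fps_XD (pint z f) = letter z * f"
proof (rule fps_ext)
  fix n
  show "fps_nth (fps_XD (pint z f)) n = fps_nth (letter z * f) n"
    using assms
    by (cases n) (auto simp: fps_XD_nth pint_def fps_mult_nth_0 letter_nth_0 simp del: of_nat_Suc)
qed

lemma pint_eqI:
  assumes "fps_XD g = letter z * f" "fps_nth g 0 = 0"
  shows "g = pint z f"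
proof (rule fps_ext)
  fix n
  have "of_nat n * fps_nth g n = fps_nth (letter z * f) n"
    unfolding assms(1)[symmetric] by (simp add: fps_XD_nth)
  then show "fps_nth g n = fps_nth (pint z f) n"
    using assms(2) by (cases "n = 0") (auto simp: pint_def divide_simps mult.commute)
qed

lemma pint_add: "pint z (f + g) = pint z f + pint z g"
  by (rule fps_ext) (simp add: pint_def distrib_left add_divide_distrib)

lemma pint_const_mult: "pint z (fps_const c * f) = fps_const c * pint z f"
  by (rule fps_ext) (simp add: pint_def mult.left_commute[of "letter z"])

text \<open>The flag records whether the outermost letter differs from 1, i.e. whether the series
  converges at 1.\<close>

inductive polylog :: "bool \<Rightarrow> nat \<Rightarrow> complex fps \<Rightarrow> bool" where
  one: "polylog c 0 1"
| integ: "polylog b w f \<Longrightarrow> z ^ 4 = 1 \<or> z = 0 \<and> w \<ge> 1 \<Longrightarrow> (c \<Longrightarrow> z \<noteq> 1) \<Longrightarrow> polylog c (Suc w) (pint z f)"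
| add: "polylog c w f \<Longrightarrow> polylog c w g \<Longrightarrow> polylog c w (f + g)"
| scale: "polylog c w f \<Longrightarrow> polylog c w (fps_const (of_rat q) * f)"

lemma polylog_weaken: "polylog b w f \<Longrightarrow> polylog False w f"
  by (induction rule: polylog.induct) (auto intro: polylog.intros)

text \<open>In positive weight every term is an integral from 0. Hence integration against dx/x is
  legitimate as soon as the weight is at least 1.\<close>

lemma polylog_nth_0: "polylog c w f \<Longrightarrow> w \<ge> 1 \<Longrightarrow> fps_nth f 0 = 0"
  by (induction rule: polylog.induct) auto

lemma polylog_uminus: "polylog c w f \<Longrightarrow> polylog c w (- f)"
  using polylog.scale[of c w f "-1"] by (simp add: of_rat_minus flip: fps_const_neg)

lemma polylog_diff: "polylog c w f \<Longrightarrow> polylog c w g \<Longrightarrow> polylog c w (f - g)"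
  using polylog.add[OF _ polylog_uminus, of c w f g] by simp

lemma XD_mult: "fps_XD (f * g) = fps_XD f * g + f * fps_XD (g :: complex fps)"
  by (simp add: fps_XD_def algebra_simps)

text \<open>The shuffle product: \<open>f * g\<close> is recovered from \<open>x (f g)' = (x f') g + f (x g')\<close>.\<close>

lemma polylog_mult:
  assumes "polylog a v f" "polylog b w g"
  shows "polylog (a \<and> b) (v + w) (f * g)"
  using assms
proof (induction arbitrary: b w g rule: polylog.induct)
  case (one c)
  then show ?case by (cases c) (auto intro: polylog_weaken)
next
  case (add c v f1 f2)
  then show ?case by (simp add: distrib_right polylog.add)
next
  case (scale c v f q)
  then show ?case by (simp add: mult.assoc polylog.scale)
next
  case (integ a' v f x a)
  note f = integ.hyps and f_IH = integ.IH
  from \<open>polylog b w g\<close> show ?case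
  proof (induction rule: polylog.induct)
    case (one c)
    have "polylog a (Suc v) (pint x f)" using f by (intro polylog.integ) auto
    then show ?case by (cases c) (auto intro: polylog_weaken)
  next
    case (add c w f1 f2)
    then show ?case by (simp add: distrib_left polylog.add)
  next
    case (scale c w f q)
    then show ?case using polylog.scale by (simp add: mult.left_commute)
  next
    case (integ b' w g y b)
    have z: "x \<noteq> 0 \<or> fps_nth f 0 = 0" "y \<noteq> 0 \<or> fps_nth g 0 = 0"
      using f integ.hyps polylog_nth_0 by auto
    have "polylog b (Suc w) (pint y g)" using integ.hyps by (intro polylog.integ) auto
    from f_IH[OF this] have 1: "polylog (a' \<and> b) (v + Suc w) (f * pint y g)" .
    have 2: "polylog (a \<and> b') (Suc v + w) (pint x f * g)" by (rule integ.IH)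
    have zero: "fps_nth h 0 = 0 \<or> fps_nth k 0 = 0 \<Longrightarrow> fps_nth (h * k) 0 = 0" for h k :: "complex fps"
      by (simp add: fps_mult_nth_0)
    have eq: "pint x f * pint y g = pint x (f * pint y g) + pint y (pint x f * g)"
    proof -
      \<comment> \<open>\<open>pint_eqI\<close> recognizes a single integral, so one of the two is
        subtracted beforehand.\<close>
      define h where "h = pint x f * pint y g - pint y (pint x f * g)"
      have "fps_XD h + fps_XD (pint y (pint x f * g)) = fps_XD (pint x f * pint y g)"
        unfolding h_def by (simp flip: fps_XD_add)
      then have "fps_XD h = letter x * (f * pint y g)"
        using z by (simp add: XD_mult XD_pint zero algebra_simps)
      then have "h = pint x (f * pint y g)"
        by (rule pint_eqI) (simp add: h_def fps_mult_nth_0)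
      then show ?thesis by (simp add: h_def algebra_simps)
    qed
    \<comment> \<open>The outermost letter of either integral is that of one of the factors, so
      convergence at 1 is inherited.\<close>
    have "polylog (a \<and> b) (Suc (v + Suc w)) (pint x (f * pint y g))"
      using f 1 by (intro polylog.integ[OF 1]) auto
    moreover have "polylog (a \<and> b) (Suc (Suc v + w)) (pint y (pint x f * g))"
      using integ.hyps 2 by (intro polylog.integ[OF 2]) auto
    ultimately show ?case unfolding eq by (intro polylog.add) auto
  qed
qed


subsection \<open>Coefficients\<close>

text \<open>The multiple polylogarithm: tuples with outermost index n contribute to the coefficient
  of x^n, and the empty index gives 1. Taking differences makes the partial sums of the coefficients
  equal to \<open>colored_sum\<close>.\<close>

definition lif :: "(nat \<times> complex) list \<Rightarrow> complex fps" where
  "lif azs = Abs_fps (\<lambda>n. case n of 0 \<Rightarrow> colored_sum 0 azs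
                              | Suc k \<Rightarrow> colored_sum n azs - colored_sum k azs)"

lemma sum_lif: "(\<Sum>k\<le>n. fps_nth (lif azs) k) = colored_sum n azs"
  by (induction n) (simp_all add: lif_def)

lemma lif_Nil: "lif [] = 1"
  by (rule fps_ext) (simp add: lif_def split: nat.splits)

lemma lif_Cons_nth_0 [simp]: "fps_nth (lif (x # azs)) 0 = 0"
  by (simp add: lif_def)

lemma lif_Cons_nth_Suc:
  "fps_nth (lif ((a, z) # azs)) (Suc n) = z ^ Suc n / of_nat (Suc n) ^ a * colored_sum n azs"
  by (simp add: lif_def colored_sum_Suc_Cons)

text \<open>Integrating against \<open>z dx / (1 - z x)\<close> multiplies the \<open>k\<close>-th coefficient by
  \<open>z^(n - k)\<close>, hence the division by \<open>z\<close> in the first remaining entry.\<close>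

fun twist :: "complex \<Rightarrow> (nat \<times> complex) list \<Rightarrow> (nat \<times> complex) list" where
  "twist z [] = []"
| "twist z ((a, y) # azs) = (a, y / z) # azs"

fun prepend :: "complex \<Rightarrow> (nat \<times> complex) list \<Rightarrow> (nat \<times> complex) list" where
  "prepend z [] = [(1, z)]"
| "prepend z ((a, y) # azs) = (if z = 0 then (Suc a, y) # azs else (1, z) # (a, y / z) # azs)"

lemma prepend_nonzero: "z \<noteq> 0 \<Longrightarrow> prepend z azs = (1, z) # twist z azs"
  by (cases "(z, azs)" rule: prepend.cases) auto

lemma lif_twist: "z \<noteq> 0 \<Longrightarrow> fps_nth (lif (twist z azs)) n = fps_nth (lif azs) n / z ^ n"
proof (cases azs)
  case (Cons x r)
  then show ?thesis
    by (cases x; cases n) (simp_all add: lif_Cons_nth_Suc power_divide del: power_Suc of_nat_Suc)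
qed (auto simp: lif_Nil)

lemma pint_lif:
  assumes "z = 0 \<Longrightarrow> azs \<noteq> []"
  shows "pint z (lif azs) = lif (prepend z azs)"
proof (rule fps_ext)
  fix n
  show "fps_nth (pint z (lif azs)) n = fps_nth (lif (prepend z azs)) n"
  proof (cases n)
    case 0
    then show ?thesis by (cases "(z, azs)" rule: prepend.cases) auto
  next
    case (Suc m)
    show ?thesis
    proof (cases "z = 0")
      case True
      with assms obtain a y r where "azs = (a, y) # r" by (cases azs) auto
      with True Suc show ?thesis by (simp add: pint_def lif_Cons_nth_Suc del: of_nat_Suc)
    next
      case False
      have "fps_nth (letter z * lif azs) n = (\<Sum>k\<le>n. fps_nth (lif azs) k * fps_nth (letter z) (n - k))"
        unfolding mult.commute[of "letter z"] fps_mult_nth atLeast0AtMost ..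
      \<comment> \<open>The letter has no constant term, so k = n drops out; this makes the new
        outermost inequality strict.\<close>
      also have "\<dots> = (\<Sum>k\<le>m. fps_nth (lif azs) k * z ^ (n - k))"
        using False Suc by (simp add: letter_def Suc_diff_le)
      also have "\<dots> = z ^ n * (\<Sum>k\<le>m. fps_nth (lif (twist z azs)) k)"
        unfolding sum_distrib_left
        by (rule sum.cong) (auto simp: lif_twist False Suc power_diff)
      also have "\<dots> = z ^ n * colored_sum m (twist z azs)" by (simp add: sum_lif)
      finally show ?thesis
        using False Suc by (simp add: pint_def prepend_nonzero lif_Cons_nth_Suc)
    qed
  qed
qed

definition index :: "nat \<Rightarrow> (nat \<times> complex) list \<Rightarrow> bool" where
  "index w azs \<longleftrightarrow> (\<forall>(a, z) \<in> set azs. a \<ge> 1 \<and> z ^ 4 = 1) \<and> weight azs = w"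

lemma index_prepend:
  assumes "index w azs" "z ^ 4 = 1 \<or> z = 0 \<and> w \<ge> 1"
  shows "index (Suc w) (prepend z azs)"
  using assms
  by (cases "(z, azs)" rule: prepend.cases) (auto simp: index_def weight_def power_divide)

lemma polylog_imp_lif:
  assumes "polylog c w f"
  shows "\<exists>xs. f = (\<Sum>(q, azs)\<leftarrow>xs. fps_const (of_rat q) * lif azs) \<and>
              (\<forall>(q, azs)\<in>set xs. index w azs \<and> (c \<longrightarrow> azs \<noteq> [] \<longrightarrow> hd azs \<noteq> (1, 1)))"
  using assms
proof (induction rule: polylog.induct)
  case (one c)
  show ?case
    by (rule exI[of _ "[(1, [])]"]) (simp add: lif_Nil index_def weight_def)
next
  case (add c w f g)
  then obtain xs ys where xs:
    "f = (\<Sum>(q, azs)\<leftarrow>xs. fps_const (of_rat q) * lif azs)"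
    "\<forall>(q, azs)\<in>set xs. index w azs \<and> (c \<longrightarrow> azs \<noteq> [] \<longrightarrow> hd azs \<noteq> (1, 1))"
    and ys: "g = (\<Sum>(q, azs)\<leftarrow>ys. fps_const (of_rat q) * lif azs)"
    "\<forall>(q, azs)\<in>set ys. index w azs \<and> (c \<longrightarrow> azs \<noteq> [] \<longrightarrow> hd azs \<noteq> (1, 1))"
    by blast
  show ?case
    by (rule exI[of _ "xs @ ys"]) (use xs(2) ys(2) in \<open>auto simp: xs(1) ys(1)\<close>)
next
  case (scale c w f r)
  then obtain xs where xs:
    "f = (\<Sum>(q, azs)\<leftarrow>xs. fps_const (of_rat q) * lif azs)"
    "\<forall>(q, azs)\<in>set xs. index w azs \<and> (c \<longrightarrow> azs \<noteq> [] \<longrightarrow> hd azs \<noteq> (1, 1))"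
    by blast
  have "fps_const (of_rat r) * (\<Sum>(q, azs)\<leftarrow>xs. fps_const (of_rat q) * lif azs)
      = (\<Sum>(q, azs)\<leftarrow>map (\<lambda>(q, azs). (r * q, azs)) xs. fps_const (of_rat q) * lif azs)"
    by (induction xs) (auto simp: distrib_left of_rat_mult mult.assoc simp flip: fps_const_mult)
  then show ?case
    by (intro exI[of _ "map (\<lambda>(q, azs). (r * q, azs)) xs"]) (use xs(2) in \<open>auto simp: xs(1)\<close>)
next
  case (integ b w f z c)
  then obtain xs where xs:
    "f = (\<Sum>(q, azs)\<leftarrow>xs. fps_const (of_rat q) * lif azs)"
    "\<forall>(q, azs)\<in>set xs. index w azs"
    by blast
  have ne: "azs \<noteq> []" if "index w azs" "z = 0" for azs
    using that integ.hyps by (auto simp: index_def weight_def)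
  have "pint z (\<Sum>(q, azs)\<leftarrow>xs. fps_const (of_rat q) * lif azs)
      = (\<Sum>(q, azs)\<leftarrow>map (\<lambda>(q, azs). (q, prepend z azs)) xs. fps_const (of_rat q) * lif azs)"
    using xs(2)
  proof (induction xs)
    case Nil
    have "pint z 0 = 0" by (rule fps_ext) (simp add: pint_def)
    then show ?case by simp
  qed (auto simp: pint_add pint_const_mult pint_lif ne)
  \<comment> \<open>The letter 0 raises the outermost exponent to at least 2; any other letter
    becomes the outermost color itself.\<close>
  moreover have "hd (prepend z azs) \<noteq> (1, 1)" if "index w azs" "c" for azs
    using that integ.hyps
    by (cases "(z, azs)" rule: prepend.cases) (auto simp: index_def)
  ultimately show ?case
    using xs(2) integ.hyps index_prepend
    by (intro exI[of _ "map (\<lambda>(q, azs). (q, prepend z azs)) xs"]) (auto simp: xs(1))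
qed

lemma root_of_unity_norm: "norm z = 1" if "z ^ 4 = (1 :: complex)"
proof -
  have "norm z ^ 4 = 1 ^ 4" using that by (simp flip: norm_power)
  then show ?thesis using power_eq_imp_eq_base[of "norm z" 4 1] by simp
qed

lemma polylog_sums_CMZV:
  assumes "polylog True w f"
  shows "\<exists>v\<in>CMZV 4 w. fps_nth f sums v"
proof -
  obtain xs where xs:
    "f = (\<Sum>(q, azs)\<leftarrow>xs. fps_const (of_rat q) * lif azs)"
    "\<forall>(q, azs)\<in>set xs. index w azs \<and> (azs \<noteq> [] \<longrightarrow> hd azs \<noteq> (1, 1))"
    using polylog_imp_lif[OF assms, unfolded simp_thms] by (elim exE conjE)
  have "(\<Sum>(q, azs)\<leftarrow>xs. of_rat q * colored_mzv azs) \<in> CMZV 4 w \<and>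
        fps_nth (\<Sum>(q, azs)\<leftarrow>xs. fps_const (of_rat q) * lif azs) sums
          (\<Sum>(q, azs)\<leftarrow>xs. of_rat q * colored_mzv azs)"
    using xs(2)
  proof (induction xs)
    case Nil
    then show ?case by (simp add: CMZV_def rat_complex.span_zero)
  next
    case (Cons x xs)
    obtain q azs where x: "x = (q, azs)" by force
    have azs: "index w azs" "azs \<noteq> [] \<longrightarrow> hd azs \<noteq> (1, 1)" using Cons.prems by (auto simp: x)
    then have "unit_index azs" by (auto simp: index_def unit_index_def root_of_unity_norm)
    from convergent_colored_sum[OF this azs(2)]
    have "(\<lambda>N. colored_sum N azs) \<longlonglongrightarrow> colored_mzv azs"
      by (simp add: colored_mzv_def convergent_LIMSEQ_iff)
    then have "fps_nth (lif azs) sums colored_mzv azs"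
      by (simp add: sums_def_le sum_lif)
    then have 1: "(\<lambda>n. of_rat q * fps_nth (lif azs) n) sums (of_rat q * colored_mzv azs)"
      by (rule sums_mult)
    have "colored_mzv azs \<in> CMZV 4 w"
      using azs unfolding CMZV_def
      by (intro rat_complex.span_base CollectI exI[of _ azs]) (auto simp: index_def admissible_def)
    then have 2: "of_rat q * colored_mzv azs \<in> CMZV 4 w"
      unfolding CMZV_def by (rule rat_complex.span_scale)
    have "(\<Sum>(q, azs)\<leftarrow>xs. of_rat q * colored_mzv azs) \<in> CMZV 4 w"
      and 3: "fps_nth (\<Sum>(q, azs)\<leftarrow>xs. fps_const (of_rat q) * lif azs) sums
          (\<Sum>(q, azs)\<leftarrow>xs. of_rat q * colored_mzv azs)"
      using Cons by auto
    with 2 have "of_rat q * colored_mzv azs + (\<Sum>(q, azs)\<leftarrow>xs. of_rat q * colored_mzv azs) \<in> CMZV 4 w"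
      unfolding CMZV_def by (intro rat_complex.span_add)
    then show ?case using sums_add[OF 1 3] by (simp add: x)
  qed
  then show ?thesis unfolding xs(1) by blast
qed


subsection \<open>Values and boundary values\<close>

definition pval :: "complex fps \<Rightarrow> real \<Rightarrow> complex" where
  "pval f t = eval_fps f (of_real t)"

definition form :: "complex \<Rightarrow> real \<Rightarrow> complex" where
  "form z t = (if z = 0 then 1 / of_real t else z / (1 - z * of_real t))"

lemma conv_radius_mono:
  fixes f g :: "nat \<Rightarrow> 'a :: {banach, real_normed_div_algebra}"
  assumes "\<And>n. n \<ge> 1 \<Longrightarrow> norm (g n) \<le> norm (f n)"
  shows "conv_radius f \<le> conv_radius g"
proof (rule conv_radius_geI_ex')
  fix r assume r: "0 < r" "ereal r < conv_radius f"
  have "summable (\<lambda>n. norm (f n * of_real r ^ n))"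
    using r by (intro abs_summable_in_conv_radius) simp
  then show "summable (\<lambda>n. g n * of_real r ^ n)"
    by (rule summable_comparison_test[rotated], intro exI[of _ 1])
      (use assms r in \<open>auto simp: norm_mult norm_power intro!: mult_right_mono\<close>)
qed

lemma fps_conv_radius_letter: "fps_conv_radius (letter z) \<ge> 1" if "norm z = 1 \<or> z = 0"
proof -
  have "conv_radius (\<lambda>_. 1 :: complex) \<le> fps_conv_radius (letter z)"
    unfolding fps_conv_radius_def
    by (rule conv_radius_mono)
      (use that in \<open>auto simp: letter_def norm_power power_0_left\<close>)
  moreover have "1 \<le> conv_radius (\<lambda>_. 1 :: complex)"
    by (rule conv_radius_geI_ex') (auto intro!: summable_geometric)
  ultimately show ?thesis by (rule order_trans[rotated])
qed

lemma fps_conv_radius_pint: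
  assumes "norm z = 1 \<or> z = 0" "fps_conv_radius f \<ge> 1"
  shows "fps_conv_radius (pint z f) \<ge> 1"
proof -
  have "1 \<le> min (fps_conv_radius (letter z)) (fps_conv_radius f)"
    using assms fps_conv_radius_letter by simp
  also have "\<dots> \<le> fps_conv_radius (letter z * f)" by (rule fps_conv_radius_mult)
  also have "\<dots> \<le> fps_conv_radius (pint z f)"
    unfolding fps_conv_radius_def
  proof (rule conv_radius_mono)
    fix n :: nat assume "n \<ge> 1"
    have "norm (fps_nth (pint z f) n) = norm (fps_nth (letter z * f) n) / real n"
      by (simp add: pint_def norm_divide)
    also have "\<dots> \<le> norm (fps_nth (letter z * f) n) / 1"
      using \<open>n \<ge> 1\<close> by (intro divide_left_mono) auto
    finally show "norm (fps_nth (pint z f) n) \<le> norm (fps_nth (letter z * f) n)" by simp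
  qed
  finally show ?thesis .
qed

lemma fps_conv_radius_polylog: "polylog c w f \<Longrightarrow> fps_conv_radius f \<ge> 1"
proof (induction rule: polylog.induct)
  case (add c w f g)
  then show ?case using fps_conv_radius_add[of f g] by (meson min.boundedI order_trans)
next
  case (scale c w f q)
  then show ?case
    by (cases "(of_rat q :: complex) = 0") (simp_all add: fps_conv_radius_cmult_left)
qed (auto intro!: fps_conv_radius_pint simp: root_of_unity_norm)

lemma radius_less:
  assumes "fps_conv_radius f \<ge> 1" "\<bar>t\<bar> < 1"
  shows "ereal (norm (complex_of_real t)) < fps_conv_radius f"
proof -
  have "ereal (norm (complex_of_real t)) < 1" using assms(2) by simp
  then show ?thesis using assms(1) by (rule less_le_trans)
qed

lemma polylog_radius: "polylog c w f \<Longrightarrow> \<bar>t\<bar> < 1 \<Longrightarrow> ereal (norm (complex_of_real t)) < fps_conv_radius f"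
  by (intro radius_less fps_conv_radius_polylog)

lemma pval_0: "pval f 0 = fps_nth f 0"
  by (simp add: pval_def eval_fps_at_0)

lemma pval_one [simp]: "pval 1 t = 1"
  by (simp add: pval_def)

lemma pval_add:
  "polylog b v f \<Longrightarrow> polylog c w g \<Longrightarrow> \<bar>t\<bar> < 1 \<Longrightarrow> pval (f + g) t = pval f t + pval g t"
  unfolding pval_def by (intro eval_fps_add polylog_radius)

lemma pval_diff:
  "polylog b v f \<Longrightarrow> polylog c w g \<Longrightarrow> \<bar>t\<bar> < 1 \<Longrightarrow> pval (f - g) t = pval f t - pval g t"
  unfolding pval_def by (intro eval_fps_diff polylog_radius)

lemma pval_mult:
  "polylog b v f \<Longrightarrow> polylog c w g \<Longrightarrow> \<bar>t\<bar> < 1 \<Longrightarrow> pval (f * g) t = pval f t * pval g t"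
  unfolding pval_def by (intro eval_fps_mult polylog_radius)

lemma pval_scale:
  "polylog b v f \<Longrightarrow> \<bar>t\<bar> < 1 \<Longrightarrow> pval (fps_const c * f) t = c * pval f t"
  unfolding pval_def using eval_fps_mult[OF _ polylog_radius, of "of_real t" "fps_const c"] by simp

lemma pval_has_vector_derivative:
  assumes "polylog c w f" "\<bar>t\<bar> < 1"
  shows "(pval f has_vector_derivative pval (fps_deriv f) t) (at t within A)"
proof -
  have "(eval_fps f has_field_derivative eval_fps (fps_deriv f) (of_real t)) (at (of_real t))"
    using polylog_radius[OF assms] by (rule has_field_derivative_eval_fps)
  from has_vector_derivative_real_field[OF this] show ?thesis
    unfolding pval_def[abs_def] .
qed

lemma isCont_pval: "polylog c w f \<Longrightarrow> \<bar>t\<bar> < 1 \<Longrightarrow> isCont (pval f) t"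
  using pval_has_vector_derivative has_vector_derivative_continuous by blast

lemma eval_letter:
  assumes "norm z = 1 \<or> z = 0" "\<bar>t\<bar> < 1" "t \<noteq> 0"
  shows "eval_fps (letter z) (of_real t) = of_real t * form z t"
proof (cases "z = 0")
  case False
  define y where "y = z * of_real t"
  have y: "norm y < 1" using assms False by (simp add: y_def norm_mult)
  have "(\<lambda>n. fps_nth (letter z) n * of_real t ^ n) sums eval_fps (letter z) (of_real t)"
    using assms by (intro sums_eval_fps radius_less fps_conv_radius_letter)
  moreover have "(\<lambda>n. fps_nth (letter z) n * of_real t ^ n) = (\<lambda>n. y ^ n - (if n = 0 then 1 else 0))"
    using False by (auto simp: letter_def y_def power_mult_distrib)
  moreover have "(\<lambda>n. y ^ n - (if n = 0 then 1 else 0)) sums (1 / (1 - y) - 1)"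
    using geometric_sums[OF y] sums_single[of 0 "\<lambda>_. 1::complex"]
    by (intro sums_diff) simp_all
  ultimately have "eval_fps (letter z) (of_real t) = 1 / (1 - y) - 1"
    by (simp add: sums_unique2)
  also have "1 - y \<noteq> 0" using y by auto
  then have "1 / (1 - y) - 1 = y / (1 - y)" by (simp add: field_simps)
  finally show ?thesis using False by (simp add: form_def y_def mult_ac)
qed (use assms in \<open>simp add: form_def\<close>)

text \<open>The series identity of \<open>XD_pint\<close> is divided by t, hence the restriction to
  t > 0, where \<open>form 0\<close> has no pole.\<close>

lemma pval_pint_has_vector_derivative:
  assumes "polylog c w f" "z ^ 4 = 1 \<or> z = 0 \<and> w \<ge> 1" "0 < t" "t < 1"
  shows "(pval (pint z f) has_vector_derivative form z t * pval f t) (at t within A)"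
proof -
  have pl: "polylog False (Suc w) (pint z f)" using assms by (intro polylog.integ) auto
  have z: "norm z = 1 \<or> z = 0" using assms root_of_unity_norm by auto
  have t: "\<bar>t\<bar> < 1" using assms by simp
  have "z \<noteq> 0 \<or> fps_nth f 0 = 0" using assms polylog_nth_0 by auto
  then have XD: "fps_X * fps_deriv (pint z f) = letter z * f"
    using XD_pint by (simp add: fps_XD_def)
  have r: "ereal (norm (complex_of_real t)) < fps_conv_radius (fps_deriv (pint z f))"
    using polylog_radius[OF pl t] fps_conv_radius_deriv less_le_trans by blast
  have "of_real t * pval (fps_deriv (pint z f)) t = eval_fps (letter z * f) (of_real t)"
    unfolding pval_def XD[symmetric] using r by (subst eval_fps_mult) auto
  also have "\<dots> = of_real t * form z t * pval f t"
    using assms eval_fps_mult[OF radius_less[OF fps_conv_radius_letter[OF z] t] polylog_radius[OF assms(1) t]]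
    by (simp add: pval_def eval_letter[OF z t])
  finally have "pval (fps_deriv (pint z f)) t = form z t * pval f t" using assms by simp
  then show ?thesis using pval_has_vector_derivative[OF pl t] by metis
qed

text \<open>Abel's limit theorem: with \<open>S n\<close> the error of the \<open>n\<close>-th partial sum,
  \<open>f t - v = (1 - t) (\<Sum>n. S n t^n)\<close>.\<close>

lemma pval_tendsto_sum:
  assumes f: "fps_nth f sums v" and radius: "fps_conv_radius f \<ge> 1"
  shows "(pval f \<longlongrightarrow> v) (at_left 1)"
proof -
  define S where "S = (\<lambda>n. (\<Sum>k\<le>n. fps_nth f k) - v)"
  have S: "S \<longlonglongrightarrow> 0"
    using f unfolding sums_def_le S_def by (simp add: LIM_zero)
  have S_Suc: "S (Suc n) - S n = fps_nth f (Suc n)" for n by (simp add: S_def)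
  obtain B where B: "B > 0" "\<And>n. norm (S n) \<le> B"
    using convergent_imp_Bseq[OF convergentI[OF S]] by (auto simp: Bseq_def)
  have sumS: "summable (\<lambda>n. norm (S n) * t ^ n)" if "0 < t" "t < 1" for t :: real
    by (rule summable_comparison_test[of _ "\<lambda>n. B * t ^ n"])
      (use that B in \<open>auto intro!: summable_mult summable_geometric mult_right_mono\<close>)
  have eq: "pval f t - v = (1 - of_real t) * (\<Sum>n. S n * of_real t ^ n)" if t: "0 < t" "t < 1" for t
  proof -
    define g where "g = (\<lambda>n. S n * of_real t ^ n)"
    have "summable (\<lambda>n. norm (g n))"
      using sumS[OF t] t by (simp add: g_def norm_mult norm_power)
    then have g: "summable g" by (rule summable_norm_cancel)
    have fs: "(\<lambda>n. fps_nth f n * of_real t ^ n) sums pval f t"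
      unfolding pval_def using t radius by (intro sums_eval_fps radius_less) auto
    then have fs': "(\<lambda>n. fps_nth f (Suc n) * of_real t ^ Suc n) sums (pval f t - fps_nth f 0)"
      using sums_Suc_iff[of "\<lambda>n. fps_nth f n * of_real t ^ n"] by simp
    have "(\<lambda>n. g (Suc n) - of_real t * g n) sums ((suminf g - g 0) - of_real t * suminf g)"
      using summable_sums[OF g] sums_Suc_iff[of g "suminf g - g 0"]
      by (intro sums_diff sums_mult) auto
    moreover have "g (Suc n) - of_real t * g n = fps_nth f (Suc n) * of_real t ^ Suc n" for n
      unfolding g_def S_Suc[symmetric] by (simp add: algebra_simps)
    ultimately have "pval f t - fps_nth f 0 = (suminf g - g 0) - of_real t * suminf g"
      using fs' by (simp add: sums_unique2)
    then show ?thesis by (simp add: g_def S_def algebra_simps)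
  qed
  show ?thesis
  proof (rule tendstoI)
    fix e :: real assume "e > 0"
    then obtain N where N: "\<And>n. n \<ge> N \<Longrightarrow> norm (S n) < e / 2"
      using S by (metis LIMSEQ_iff half_gt_zero diff_zero)
    define K where "K = (\<Sum>n<N. norm (S n))"
    have "K \<ge> 0" by (simp add: K_def sum_nonneg)
    \<comment> \<open>The first N errors contribute at most (1 - t) K, which is below e/2 when 1 - t
      < d; \<open>K + 1\<close> keeps the denominator positive.\<close>
    define d where "d = e / (2 * (K + 1))"
    have "d > 0" using \<open>e > 0\<close> \<open>K \<ge> 0\<close> by (simp add: d_def)
    have "dist (pval f t) v < e" if t: "0 < t" "t < 1" "1 - d < t" for t
    proof -
      have b: "(\<lambda>n. (if n < N then norm (S n) else 0) + e / 2 * t ^ n) sums (K + e / 2 * (1 / (1 - t)))"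
        unfolding K_def using t
        by (intro sums_add sums_mult geometric_sums sums_If_finite_set[of "{..<N}", unfolded lessThan_iff]) auto
      have "norm (\<Sum>n. S n * of_real t ^ n) \<le> (\<Sum>n. norm (S n) * t ^ n)"
        using summable_norm[of "\<lambda>n. S n * of_real t ^ n"] sumS[OF t(1,2)] t
        by (simp add: norm_mult norm_power)
      also have "\<dots> \<le> (\<Sum>n. (if n < N then norm (S n) else 0) + e / 2 * t ^ n)"
      proof (rule suminf_le[OF _ sumS[OF t(1,2)] sums_summable[OF b]])
        fix n
        show "norm (S n) * t ^ n \<le> (if n < N then norm (S n) else 0) + e / 2 * t ^ n"
        proof (cases "n < N")
          case True
          have "norm (S n) * t ^ n \<le> norm (S n) * 1"
            using t by (intro mult_left_mono power_le_one) auto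
          moreover have "0 \<le> e / 2 * t ^ n" using t \<open>e > 0\<close> by simp
          ultimately show ?thesis using True by simp
        next
          case False
          then show ?thesis using N[of n] t by (auto intro!: mult_right_mono less_imp_le)
        qed
      qed
      also have "\<dots> = K + e / 2 * (1 / (1 - t))" using b by (rule sums_unique[symmetric])
      finally have "(1 - t) * norm (\<Sum>n. S n * of_real t ^ n) \<le> (1 - t) * (K + e / 2 * (1 / (1 - t)))"
        using t by (intro mult_left_mono) auto
      also have "\<dots> = (1 - t) * K + e / 2" using t by (simp add: field_simps)
      also have "(1 - t) * K \<le> d * K" using t \<open>K \<ge> 0\<close> by (intro mult_right_mono) auto
      also have "d * K < e / 2" using \<open>e > 0\<close> \<open>K \<ge> 0\<close> by (simp add: d_def field_simps)
      finally have "(1 - t) * norm (\<Sum>n. S n * of_real t ^ n) < e" by simp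
      moreover have "norm (1 - complex_of_real t) = 1 - t"
        using t by (metis abs_of_pos diff_gt_0_iff_gt norm_of_real of_real_1 of_real_diff)
      ultimately show ?thesis
        unfolding dist_norm eq[OF t(1,2)] norm_mult by simp
    qed
    then show "\<forall>\<^sub>F t in at_left 1. dist (pval f t) v < e"
      using \<open>d > 0\<close>
      by (intro eventually_at_leftI[of "max 0 (1 - d)"]) auto
  qed
qed

text \<open>A value in \<open>CMZV 4 w\<close> together with a polylogarithm that attains it.
  Products are formed for t < 1 and then pass to the limit, so conditionally convergent series never
  have to be multiplied.\<close>

definition limval :: "nat \<Rightarrow> complex \<Rightarrow> bool" where
  "limval w v \<longleftrightarrow> (\<exists>f. polylog True w f \<and> (pval f \<longlongrightarrow> v) (at_left 1))"

lemma polylog_limval: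
  assumes "polylog True w f"
  shows "\<exists>v\<in>CMZV 4 w. (pval f \<longlongrightarrow> v) (at_left 1)"
  using polylog_sums_CMZV[OF assms] pval_tendsto_sum fps_conv_radius_polylog[OF assms] by blast

lemma limval_CMZV: "limval w v \<Longrightarrow> v \<in> CMZV 4 w"
  unfolding limval_def
  using polylog_limval tendsto_unique trivial_limit_at_left_real by metis

lemma limval_one: "limval 0 1"
  unfolding limval_def by (rule exI[of _ 1]) (auto intro: polylog.one simp: pval_def[abs_def])

lemma eventually_at_left_1: "(\<And>t. 0 < t \<Longrightarrow> t < 1 \<Longrightarrow> P t) \<Longrightarrow> eventually P (at_left (1::real))"
  by (rule eventually_at_leftI[of 0]) auto

lemma limval_add:
  assumes "limval w u" "limval w v"
  shows "limval w (u + v)"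
proof -
  obtain f g where fg: "polylog True w f" "polylog True w g"
    and lim: "(pval f \<longlongrightarrow> u) (at_left 1)" "(pval g \<longlongrightarrow> v) (at_left 1)"
    using assms by (auto simp: limval_def)
  have "((\<lambda>t. pval f t + pval g t) \<longlongrightarrow> u + v) (at_left 1)"
    using lim by (rule tendsto_add)
  then have "(pval (f + g) \<longlongrightarrow> u + v) (at_left 1)"
    by (rule Lim_transform_eventually) (rule eventually_at_left_1, use fg in \<open>simp add: pval_add\<close>)
  then show ?thesis unfolding limval_def using polylog.add[OF fg] by blast
qed

lemma limval_scale:
  assumes "limval w u"
  shows "limval w (of_rat q * u)"
proof -
  obtain f where f: "polylog True w f" and lim: "(pval f \<longlongrightarrow> u) (at_left 1)"
    using assms by (auto simp: limval_def)
  have "((\<lambda>t. of_rat q * pval f t) \<longlongrightarrow> of_rat q * u) (at_left 1)"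
    using lim by (intro tendsto_intros)
  then have "(pval (fps_const (of_rat q) * f) \<longlongrightarrow> of_rat q * u) (at_left 1)"
    by (rule Lim_transform_eventually) (rule eventually_at_left_1, use f in \<open>simp add: pval_scale\<close>)
  then show ?thesis unfolding limval_def using polylog.scale[OF f] by blast
qed

lemma limval_mult:
  assumes "limval v x" "limval w y"
  shows "limval (v + w) (x * y)"
proof -
  obtain f g where fg: "polylog True v f" "polylog True w g"
    and lim: "(pval f \<longlongrightarrow> x) (at_left 1)" "(pval g \<longlongrightarrow> y) (at_left 1)"
    using assms by (auto simp: limval_def)
  have "((\<lambda>t. pval f t * pval g t) \<longlongrightarrow> x * y) (at_left 1)"
    using lim by (rule tendsto_mult)
  then have "(pval (f * g) \<longlongrightarrow> x * y) (at_left 1)"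
    by (rule Lim_transform_eventually) (rule eventually_at_left_1, use fg in \<open>simp add: pval_mult\<close>)
  moreover have "polylog True (v + w) (f * g)" using polylog_mult[OF fg] by simp
  ultimately show ?thesis unfolding limval_def by blast
qed

lemma limval_uminus: "limval w u \<Longrightarrow> limval w (- u)"
  using limval_scale[of w u "-1"] by (simp add: of_rat_minus)

lemma limval_diff: "limval w u \<Longrightarrow> limval w v \<Longrightarrow> limval w (u - v)"
  using limval_add[OF _ limval_uminus, of w u v] by simp

text \<open>Some convergent polylogarithm of weight w must exist before it can be scaled by 0; in
  positive weight, letters 1 inside and -1 outermost provide one.\<close>

lemma limval_0: "limval w 0"
proof -
  have "\<exists>f. polylog True w f"
  proof (cases w)
    case (Suc v)
    have "\<exists>f. polylog False v f"
    proof (induction v)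
      case (Suc v)
      then show ?case using polylog.integ[of False v _ 1 False] by auto
    qed (auto intro: polylog.one)
    then show ?thesis using polylog.integ[of False v _ "-1" True] Suc by auto
  qed (auto intro: polylog.one)
  then obtain f where f: "polylog True w f" ..
  then obtain v where "(pval f \<longlongrightarrow> v) (at_left 1)" using polylog_limval by blast
  with f have "limval w v" by (auto simp: limval_def)
  from limval_scale[OF this, of 0] show ?thesis by simp
qed

lemma limval_sum: "(\<And>x. x \<in> A \<Longrightarrow> limval w (f x)) \<Longrightarrow> limval w (sum f A)"
  by (induction A rule: infinite_finite_induct) (auto intro: limval_0 limval_add)

text \<open>The improper integral exists even if \<open>f\<close> diverges at 1: the outermost
  letter is not 1, so Abel's theorem supplies the endpoint value of the primitive.\<close>

lemma form_integral:
  assumes "polylog c w f" "z ^ 4 = 1 \<and> z \<noteq> 1 \<or> z = 0 \<and> w \<ge> 1"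
  obtains v where "limval (Suc w) v" "((\<lambda>t. form z t * pval f t) has_integral v) {0<..<1}"
proof -
  have pl: "polylog True (Suc w) (pint z f)" using assms by (intro polylog.integ) auto
  then obtain v where v: "(pval (pint z f) \<longlongrightarrow> v) (at_left 1)" using polylog_limval by blast
  with pl have "limval (Suc w) v" unfolding limval_def by blast
  define F where "F = (\<lambda>t. if t = 1 then v else pval (pint z f) t)"
  have F: "pval (pint z f) s = F s" if "s \<in> {..<1}" for s
    using that by (simp add: F_def)
  have cont: "isCont F t" if "\<bar>t\<bar> < 1" for t
  proof -
    have "\<forall>\<^sub>F s in nhds t. F s = pval (pint z f) s"
      by (rule eventually_mono[OF eventually_nhds_in_open[of "{..<1}" t]]) (use F that in auto)
    then show ?thesis using isCont_pval[OF pl that] isCont_cong by blast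
  qed
  have "((\<lambda>t. form z t * pval f t) has_integral (F 1 - F 0)) {0..1}"
  proof (rule fundamental_theorem_of_calculus_interior)
    show "continuous_on {0..1} F"
    proof (rule continuous_on_IccI)
      show "(F \<longlongrightarrow> F 0) (at_right 0)"
        using cont[of 0] by (simp add: isCont_def tendsto_within_subset[OF _ subset_UNIV])
      have "(F \<longlongrightarrow> v) (at_left 1)"
        by (rule Lim_transform_eventually[OF v], rule eventually_at_left_1) (use F in auto)
      then show "(F \<longlongrightarrow> F 1) (at_left 1)" by (simp add: F_def)
    qed (use cont in \<open>auto simp: isCont_def\<close>)
    fix t :: real assume "t \<in> {0<..<1}"
    then have "(pval (pint z f) has_vector_derivative form z t * pval f t) (at t)"
      using assms by (intro pval_pint_has_vector_derivative) auto
    then show "(F has_vector_derivative form z t * pval f t) (at t)"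
      by (rule has_vector_derivative_transform_within_open[of _ _ _ "{..<1}"])
        (use F \<open>t \<in> {0<..<1}\<close> in auto)
  qed simp
  moreover have "F 1 - F 0 = v" by (simp add: F_def pval_0)
  ultimately have "((\<lambda>t. form z t * pval f t) has_integral v) {0<..<1}"
    by (simp add: has_integral_Icc_iff_Ioo)
  with \<open>limval (Suc w) v\<close> show ?thesis by (rule that)
qed


section \<open>The substitution \<open>t = tan (x / 2)\<close>\<close>

text \<open>\<open>sn\<close> and \<open>cs\<close> are \<open>sin x\<close> and \<open>cos x\<close>, \<open>wt t dt = dx\<close> and \<open>lam = - ln (cos x)^2\<close>.\<close>

definition sn :: "real \<Rightarrow> real" where "sn t = 2 * t / (1 + t\<^sup>2)"
definition cs :: "real \<Rightarrow> real" where "cs t = (1 - t\<^sup>2) / (1 + t\<^sup>2)"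
definition wt :: "real \<Rightarrow> real" where "wt t = 2 / (1 + t\<^sup>2)"
definition lam :: "real \<Rightarrow> real" where "lam t = - 2 * ln (cs t)"

lemma one_plus_square_pos: "1 + t\<^sup>2 > (0::real)"
  by (simp add: add_pos_nonneg)

lemma one_plus_square_neq_0 [simp]: "1 + t\<^sup>2 \<noteq> (0::real)"
  using one_plus_square_pos[of t] by simp

lemma sn_cs: "(sn t)\<^sup>2 + (cs t)\<^sup>2 = 1"
proof -
  have "(2 * t)\<^sup>2 + (1 - t\<^sup>2)\<^sup>2 = (1 + t\<^sup>2)\<^sup>2" by algebra
  then show ?thesis by (simp add: sn_def cs_def power_divide flip: add_divide_distrib)
qed

lemma cs_square: "(cs t)\<^sup>2 = 1 - (sn t)\<^sup>2"
  using sn_cs[of t] by simp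

lemma sn_0 [simp]: "sn 0 = 0" and cs_0 [simp]: "cs 0 = 1" and lam_0 [simp]: "lam 0 = 0"
  and cs_1 [simp]: "cs 1 = 0"
  by (simp_all add: sn_def cs_def lam_def)

lemma wt_pos: "wt t > 0"
  by (simp add: wt_def one_plus_square_pos)

lemma sn_pos: "0 < t \<Longrightarrow> sn t > 0"
  by (simp add: sn_def one_plus_square_pos)

lemma cs_pos: "0 \<le> t \<Longrightarrow> t < 1 \<Longrightarrow> cs t > 0"
  by (simp add: cs_def one_plus_square_pos power_less_one_iff abs_square_less_1)

lemma cs_le_1: "cs t \<le> 1"
  using one_plus_square_pos[of t] by (simp add: cs_def divide_le_eq)

lemma lam_nonneg: "0 \<le> t \<Longrightarrow> t < 1 \<Longrightarrow> lam t \<ge> 0"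
  using cs_pos[of t] cs_le_1[of t] by (simp add: lam_def)

lemma sn_square_less_1: "0 \<le> t \<Longrightarrow> t < 1 \<Longrightarrow> (sn t)\<^sup>2 < 1"
  using cs_pos[of t] sn_cs[of t] zero_less_power[of "cs t" 2] by linarith

lemma wt_eq: "wt t = 1 + cs t"
  by (simp add: wt_def cs_def field_simps)

lemma DERIV_sn [derivative_intros]:
  "(f has_real_derivative D) (at x within A) \<Longrightarrow>
   ((\<lambda>x. sn (f x)) has_real_derivative (cs (f x) * wt (f x) * D)) (at x within A)"
proof -
  assume f: "(f has_real_derivative D) (at x within A)"
  have "(sn has_real_derivative (cs t * wt t)) (at t)" for t
    unfolding sn_def[abs_def]
    by (rule derivative_eq_intros refl)+
      (simp_all add: cs_def wt_def divide_simps, simp add: algebra_simps power2_eq_square)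
  from DERIV_chain2[OF this f] show ?thesis .
qed

lemma DERIV_cs [derivative_intros]:
  "(f has_real_derivative D) (at x within A) \<Longrightarrow>
   ((\<lambda>x. cs (f x)) has_real_derivative (- (sn (f x) * wt (f x) * D))) (at x within A)"
proof -
  assume f: "(f has_real_derivative D) (at x within A)"
  have "(cs has_real_derivative (- (sn t * wt t))) (at t)" for t
    unfolding cs_def[abs_def]
    by (rule derivative_eq_intros refl)+
      (simp_all add: sn_def wt_def divide_simps, simp add: algebra_simps power2_eq_square)
  from DERIV_chain2[OF this f] show ?thesis by simp
qed

lemma DERIV_lam:
  assumes "0 \<le> t" "t < 1"
  shows "(lam has_real_derivative (2 * (sn t / cs t) * wt t)) (at t within A)"
  unfolding lam_def[abs_def]
  using cs_pos[OF assms] by (auto intro!: derivative_eq_intros)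

lemma continuous_on_sn: "continuous_on A sn" and continuous_on_cs: "continuous_on A cs"
  unfolding sn_def[abs_def] cs_def[abs_def] by (auto intro!: continuous_intros)

text \<open>At the endpoint 0 only continuity is asked for, since the forms may be singular
  there.\<close>

lemma eq_from_derivative:
  fixes f g :: "real \<Rightarrow> 'a :: banach"
  assumes "continuous_on {0..t} f" "continuous_on {0..t} g" "f 0 = g 0" "0 \<le> t"
    and "\<And>x. 0 < x \<Longrightarrow> x < t \<Longrightarrow> (f has_vector_derivative D x) (at x)"
    and "\<And>x. 0 < x \<Longrightarrow> x < t \<Longrightarrow> (g has_vector_derivative D x) (at x)"
  shows "f t = g t"
proof -
  have "(D has_integral (f t - f 0)) {0..t}" "(D has_integral (g t - g 0)) {0..t}"
    using assms(5,6)
    by (auto intro!: fundamental_theorem_of_calculus_interior[OF assms(4) assms(1)]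
        fundamental_theorem_of_calculus_interior[OF assms(4) assms(2)] simp del: assms(3))
  from has_integral_unique[OF this] show ?thesis using assms(3) by simp
qed

subsection \<open>The logarithm and the arcus tangens as polylogarithms\<close>

lemma continuous_on_pval: "polylog c w f \<Longrightarrow> t < 1 \<Longrightarrow> continuous_on {0..t} (pval f)"
  by (intro continuous_at_imp_continuous_on ballI isCont_pval) auto

lemma fourth_roots [simp]: "(- \<i>) ^ 4 = 1" "\<i> ^ 4 = 1" "\<i> \<noteq> 1" "- \<i> \<noteq> 1"
  by (auto simp: power4_eq_xxxx complex_eq_iff)

lemma form_one_plus_minus: "0 < t \<Longrightarrow> t < 1 \<Longrightarrow> form 1 t + form (-1) t = of_real (2 * t / (1 - t\<^sup>2))"
proof -
  assume "0 < t" "t < 1"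
  then have "1 - t \<noteq> 0" "1 + t \<noteq> 0" "1 - t\<^sup>2 \<noteq> 0" by (auto simp: power2_eq_1_iff)
  then have "1 / (1 - t) - 1 / (1 + t) = 2 * t / (1 - t\<^sup>2)"
    by (simp add: divide_simps) (simp add: algebra_simps power2_eq_square)
  then have "complex_of_real (1 / (1 - t) - 1 / (1 + t)) = of_real (2 * t / (1 - t\<^sup>2))" by simp
  then show ?thesis by (simp add: form_def)
qed

lemma form_i:
  "form \<i> t = of_real (- t / (1 + t\<^sup>2)) + \<i> * of_real (1 / (1 + t\<^sup>2))"
  "form (- \<i>) t = of_real (- t / (1 + t\<^sup>2)) - \<i> * of_real (1 / (1 + t\<^sup>2))"
proof -
  have nz: "1 - \<i> * of_real t \<noteq> 0" "1 + \<i> * of_real t \<noteq> 0" by (auto simp: complex_eq_iff)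
  have c: "1 + (complex_of_real t)\<^sup>2 \<noteq> 0"
    using one_plus_square_neq_0[of t] by (metis of_real_1 of_real_add of_real_eq_0_iff of_real_power)
  have "(1 - \<i> * of_real t) * (1 + \<i> * of_real t) = 1 + (complex_of_real t)\<^sup>2"
    by (simp add: algebra_simps power2_eq_square)
  then have inv: "1 / (1 - \<i> * of_real t) = (1 + \<i> * of_real t) / (1 + (complex_of_real t)\<^sup>2)"
    "1 / (1 + \<i> * of_real t) = (1 - \<i> * of_real t) / (1 + (complex_of_real t)\<^sup>2)"
    using nz c by (simp_all add: field_simps)
  have "form \<i> t = \<i> * (1 / (1 - \<i> * of_real t))" by (simp add: form_def)
  also have "\<dots> = (- of_real t + \<i>) / (1 + (complex_of_real t)\<^sup>2)"
    unfolding inv by (simp add: distrib_left)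
  finally show "form \<i> t = of_real (- t / (1 + t\<^sup>2)) + \<i> * of_real (1 / (1 + t\<^sup>2))"
    by (simp add: add_divide_distrib diff_divide_distrib)
  have "form (- \<i>) t = - \<i> * (1 / (1 + \<i> * of_real t))" by (simp add: form_def)
  also have "\<dots> = (- of_real t - \<i>) / (1 + (complex_of_real t)\<^sup>2)"
    unfolding inv by (simp add: right_diff_distrib)
  finally show "form (- \<i>) t = of_real (- t / (1 + t\<^sup>2)) - \<i> * of_real (1 / (1 + t\<^sup>2))"
    by (simp add: add_divide_distrib diff_divide_distrib)
qed

text \<open>The two real forms contained in the letters \<i> and -\<i>: the difference is \<i> dx
  with x = 2 arctan t, the sum is -d ln (1 + t^2). Integrals against dx therefore cost a factor
  \<i>.\<close>

lemma form_i_diff: "form \<i> t - form (- \<i>) t = \<i> * of_real (wt t)"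
  and form_i_add: "form \<i> t + form (- \<i>) t = - of_real (sn t)"
  by (simp_all add: form_i wt_def sn_def)

lemma polylog_pint_one: "z ^ 4 = 1 \<Longrightarrow> (c \<Longrightarrow> z \<noteq> 1) \<Longrightarrow> polylog c 1 (pint z 1)"
  using polylog.integ[OF polylog.one[of c], of z c] by simp

lemma polylog_power: "polylog c v f \<Longrightarrow> polylog c (n * v) (f ^ n)"
proof (induction n)
  case (Suc n)
  then have "polylog (c \<and> c) (v + n * v) (f * f ^ n)" by (intro polylog_mult) auto
  then show ?case by simp
qed (auto intro: polylog.one)

lemma pval_power:
  assumes "polylog c v f" "\<bar>t\<bar> < 1"
  shows "pval (f ^ n) t = pval f t ^ n"
  by (induction n) (simp_all add: pval_mult[OF assms(1) polylog_power[OF assms(1)] assms(2)])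

definition atan_fps :: "complex fps" where "atan_fps = pint \<i> 1 - pint (- \<i>) 1"

lemma polylog_atan: "polylog True 1 atan_fps"
  unfolding atan_fps_def by (intro polylog_diff polylog_pint_one) auto

lemma pval_atan:
  assumes "0 \<le> t" "t < 1"
  shows "pval atan_fps t = \<i> * of_real (2 * arctan t)"
proof (rule eq_from_derivative[where f = "pval atan_fps" and g = "\<lambda>t. \<i> * of_real (2 * arctan t)"
      and D = "\<lambda>t. \<i> * of_real (wt t)" and t = t])
  show "continuous_on {0..t} (pval atan_fps)"
    using polylog_atan assms(2) by (rule continuous_on_pval)
  show "continuous_on {0..t} (\<lambda>t. \<i> * of_real (2 * arctan t))"
    by (intro continuous_intros)
  fix x assume x: "0 < x" "x < t"
  have pl: "polylog True 1 (pint \<i> 1)" "polylog True 1 (pint (- \<i>) 1)"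
    by (rule polylog_pint_one; simp)+
  have "((\<lambda>x. pval (pint \<i> 1) x - pval (pint (- \<i>) 1) x) has_vector_derivative
     form \<i> x * pval 1 x - form (- \<i>) x * pval 1 x) (at x)"
    using x assms by (intro has_vector_derivative_diff pval_pint_has_vector_derivative[OF polylog.one]) auto
  then have "((\<lambda>x. pval (pint \<i> 1) x - pval (pint (- \<i>) 1) x) has_vector_derivative
     \<i> * of_real (wt x)) (at x)"
    by (simp flip: form_i_diff)
  then show "(pval atan_fps has_vector_derivative \<i> * of_real (wt x)) (at x)"
    by (rule has_vector_derivative_transform_within_open[of _ _ _ "{0<..<1}"])
      (use x assms pl in \<open>auto simp: atan_fps_def pval_diff\<close>)
  have "((\<lambda>t. 2 * arctan t) has_real_derivative wt x) (at x)"
    unfolding wt_def by (auto intro!: derivative_eq_intros simp: divide_simps)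
  then show "((\<lambda>t. \<i> * of_real (2 * arctan t)) has_vector_derivative \<i> * of_real (wt x)) (at x)"
    by (intro has_vector_derivative_mult_right has_vector_derivative_of_real)
qed (use assms in \<open>auto simp: pval_0 atan_fps_def\<close>)

text \<open>From cos x = (1 - t^2) / (1 + t^2): the letters 1 and -1 integrate to -ln (1 - t^2), the
  letters \<i> and -\<i> to -ln (1 + t^2). The letter 1 reflects the divergence at x = pi/2.\<close>

definition lam_fps :: "complex fps" where
  "lam_fps = fps_const (of_rat 2) * ((pint 1 1 + pint (- 1) 1) - (pint \<i> 1 + pint (- \<i>) 1))"

lemma polylog_lam: "polylog False 1 lam_fps"
  unfolding lam_fps_def
  by (intro polylog.scale polylog_diff polylog.add polylog_pint_one) auto

lemma pval_lam:
  assumes "0 \<le> t" "t < 1"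
  shows "pval lam_fps t = of_real (lam t)"
proof (rule eq_from_derivative[where f = "pval lam_fps" and g = "\<lambda>t. complex_of_real (lam t)"
      and D = "\<lambda>t. of_real (2 * (sn t / cs t) * wt t)" and t = t])
  show "continuous_on {0..t} (pval lam_fps)"
    using polylog_lam assms(2) by (rule continuous_on_pval)
  have "isCont lam x" if "x \<in> {0..t}" for x
    using DERIV_lam[of x UNIV] that assms by (intro DERIV_isCont) auto
  then show "continuous_on {0..t} (\<lambda>t. complex_of_real (lam t))"
    by (intro continuous_on_of_real continuous_at_imp_continuous_on) auto
  fix x assume x: "0 < x" "x < t"
  define g where "g = (\<lambda>x. 2 * ((pval (pint 1 1) x + pval (pint (- 1) 1) x)
                       - (pval (pint \<i> 1) x + pval (pint (- \<i>) 1) x)))"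
  have pl: "polylog False 1 (pint \<i> 1)" "polylog False 1 (pint (- \<i>) 1)"
    "polylog False 1 (pint 1 1)" "polylog False 1 (pint (- 1) 1)"
    by (rule polylog_pint_one; simp)+
  have eq: "g x = pval lam_fps x" if "x \<in> {0<..<1}" for x
  proof -
    have "\<bar>x\<bar> < 1" using that by auto
    then show ?thesis
      unfolding lam_fps_def g_def
      using pl by (simp add: pval_scale[OF polylog_diff[OF polylog.add polylog.add]]
           pval_diff[OF polylog.add polylog.add] pval_add del: of_rat_numeral_eq) simp
  qed
  have "(g has_vector_derivative 2 * ((form 1 x * pval 1 x + form (- 1) x * pval 1 x)
       - (form \<i> x * pval 1 x + form (- \<i>) x * pval 1 x))) (at x)"
    unfolding g_def using x assms
    by (intro has_vector_derivative_mult_right has_vector_derivative_diff has_vector_derivative_add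
        pval_pint_has_vector_derivative[OF polylog.one]) auto
  moreover have "2 * ((form 1 x * pval 1 x + form (- 1) x * pval 1 x)
       - (form \<i> x * pval 1 x + form (- \<i>) x * pval 1 x)) = of_real (2 * (sn x / cs x) * wt x)"
  proof -
    have "1 - x\<^sup>2 \<noteq> 0" using x assms by (simp add: power2_eq_1_iff)
    then have "2 * x / (1 - x\<^sup>2) + sn x = sn x / cs x * wt x"
      by (simp add: sn_def cs_def wt_def divide_simps) (simp add: algebra_simps)
    then have eq: "2 * (2 * x / (1 - x\<^sup>2) + sn x) = 2 * (sn x / cs x) * wt x" by simp
    have x1: "x < 1" using x assms by simp
    have "2 * (of_real a - - of_real b) = complex_of_real (2 * (a + b))" for a b by simp
    then show ?thesis
      unfolding pval_one mult_1_right form_one_plus_minus[OF x(1) x1] form_i_add eq[symmetric] .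
  qed
  ultimately have "(g has_vector_derivative of_real (2 * (sn x / cs x) * wt x)) (at x)" by simp
  then show "(pval lam_fps has_vector_derivative of_real (2 * (sn x / cs x) * wt x)) (at x)"
    by (rule has_vector_derivative_transform_within_open[of _ _ _ "{0<..<1}"])
      (use x assms eq in auto)
  show "((\<lambda>t. complex_of_real (lam t)) has_vector_derivative of_real (2 * (sn x / cs x) * wt x)) (at x)"
    using DERIV_lam[of x UNIV] x assms by (intro has_vector_derivative_of_real) auto
qed (use assms in \<open>auto simp: pval_0 lam_fps_def\<close>)

text \<open>Divided powers: the derivative of \<open>lamp (Suc j)\<close> is \<open>lamp j\<close>
  times that of \<open>lam\<close>, with no numerical factor.\<close>

definition lamp :: "nat \<Rightarrow> real \<Rightarrow> real" where "lamp j t = lam t ^ j / fact j"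

definition lamp_fps :: "nat \<Rightarrow> complex fps" where
  "lamp_fps j = fps_const (of_rat (1 / fact j)) * lam_fps ^ j"

lemma of_rat_inverse_fact: "(of_rat (1 / fact j) :: complex) = of_real (1 / fact j)"
proof -
  have "(of_rat (fact j) :: complex) = fact j" by (metis of_nat_fact of_rat_of_nat_eq)
  then show ?thesis by (simp add: of_rat_divide)
qed

lemma polylog_lamp: "polylog False j (lamp_fps j)"
  unfolding lamp_fps_def using polylog.scale[OF polylog_power[OF polylog_lam, of j]] by (simp only: mult_1_right)

lemma pval_lamp: "0 \<le> t \<Longrightarrow> t < 1 \<Longrightarrow> pval (lamp_fps j) t = of_real (lamp j t)"
  unfolding lamp_fps_def
  by (subst pval_scale[OF polylog_power[OF polylog_lam]])
    (auto simp: pval_power[OF polylog_lam] pval_lam lamp_def of_rat_inverse_fact)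

lemma lamp_0 [simp]: "lamp 0 t = 1"
  by (simp add: lamp_def)

lemma lamp_nonneg: "0 \<le> t \<Longrightarrow> t < 1 \<Longrightarrow> lamp j t \<ge> 0"
  by (simp add: lamp_def lam_nonneg)

lemma lam_times_lamp: "lam t * lamp j t = real (Suc j) * lamp (Suc j) t"
  by (simp add: lamp_def)

lemma DERIV_lamp_Suc:
  assumes "0 \<le> t" "t < 1"
  shows "(lamp (Suc j) has_real_derivative (2 * (sn t / cs t) * wt t * lamp j t)) (at t within A)"
proof -
  have "((\<lambda>t. lam t ^ Suc j) has_real_derivative
      (1 + real j) * (2 * (sn t / cs t) * wt t * lam t ^ j)) (at t within A)"
    by (rule DERIV_power_Suc[OF DERIV_lam[OF assms]])
  from DERIV_cdivide[OF this, of "fact (Suc j)"] show ?thesis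
    unfolding lamp_def[abs_def] by (simp add: mult_ac)
qed


section \<open>Powers of the arcus sine\<close>

definition bn :: "nat \<Rightarrow> real" where "bn n = real ((2 * n) choose n) / 4 ^ n"

lemma bn_0 [simp]: "bn 0 = 1"
  by (simp add: bn_def)

lemma bn_Suc: "(2 * real n + 2) * bn (Suc n) = (2 * real n + 1) * bn n"
proof -
  have b: "real ((2 * m) choose m) = fact (2 * m) / (fact m * fact m)" for m
    by (subst binomial_fact) (auto simp: mult_2)
  have f: "fact (2 * Suc n) = (2 * real n + 2) * (2 * real n + 1) * fact (2 * n)"
    "fact (Suc n) = (real n + 1) * fact n"
    by (simp_all add: algebra_simps)
  have nz: "real n + 1 \<noteq> 0" "(fact n :: real) \<noteq> 0" by auto
  have "(2 * x + 2) * ((2 * x + 2) * (2 * x + 1) * F / (((x + 1) * G) * ((x + 1) * G)) / (4 * H))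
      = (2 * x + 1) * (F / (G * G) / H)"
    if "x + 1 \<noteq> 0" "G \<noteq> 0" for x F G H :: real
  proof -
    have "(2 * x + 2) * ((2 * x + 2) * (2 * x + 1) * F / (((x + 1) * G) * ((x + 1) * G)) / (4 * H))
      = (4 * ((x + 1) * (x + 1)) * ((2 * x + 1) * F)) / (4 * ((x + 1) * (x + 1)) * (G * G * H))"
      by (simp add: algebra_simps)
    also have "\<dots> = ((2 * x + 1) * F) / (G * G * H)"
      using that by (intro mult_divide_mult_cancel_left) auto
    finally show ?thesis by simp
  qed
  from this[OF nz] show ?thesis unfolding bn_def b f power_Suc .
qed

lemma bn_nonneg: "bn n \<ge> 0"
  by (simp add: bn_def)

lemma bn_le_1: "bn n \<le> 1"
proof (induction n)
  case (Suc n)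
  have "(2 * real n + 2) * bn (Suc n) \<le> (2 * real n + 2) * 1"
    unfolding bn_Suc using Suc bn_nonneg[of n] by (intro mult_mono) auto
  then show ?case by (subst (asm) mult_le_cancel_left_pos) auto
qed simp

section \<open>Generating functions of central binomial coefficients times t-harmonic sums\<close>

definition gc :: "nat \<Rightarrow> nat \<Rightarrow> real" where "gc d n = bn n * t_sum n (replicate d 2)"

lemma gc_nonneg: "gc d n \<ge> 0"
  by (simp add: gc_def bn_nonneg t_sum_nonneg)

definition gser :: "nat \<Rightarrow> nat \<Rightarrow> real fps" where
  "gser d m = Abs_fps (\<lambda>n. gc d n / (2 * real n + 1) ^ m)"

lemma conv_radius_power: "1 \<le> conv_radius (\<lambda>n. real (Suc n) ^ d)"
proof -
  have "(\<lambda>n. norm (real (Suc n) ^ d) / norm (real (Suc (Suc n)) ^ d)) = (\<lambda>n. (real (Suc n) / real (Suc (Suc n))) ^ d)"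
    by (simp add: power_divide del: of_nat_Suc)
  moreover have "(\<lambda>n. (real (Suc n) / real (Suc (Suc n))) ^ d) \<longlonglongrightarrow> 1 ^ d"
    by (intro tendsto_power LIMSEQ_Suc[OF LIMSEQ_n_over_Suc_n])
  ultimately have "(\<lambda>n. norm (real (Suc n) ^ d) / norm (real (Suc (Suc n)) ^ d)) \<longlonglongrightarrow> 1"
    by simp
  then have "conv_radius (\<lambda>n. real (Suc n) ^ d) = 1"
    by (intro conv_radius_ratio_limit[where c' = 1]) (auto simp: one_ereal_def)
  then show ?thesis by simp
qed

lemma fps_conv_radius_gser: "fps_conv_radius (gser d m) \<ge> 1"
proof -
  have "conv_radius (\<lambda>n. real (Suc n) ^ d) \<le> fps_conv_radius (gser d m)"
    unfolding fps_conv_radius_def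
  proof (rule conv_radius_mono)
    fix n
    have "gc d n \<le> 1 * real (Suc n) ^ d"
      unfolding gc_def using t_sum_le[of n "replicate d 2"]
      by (intro mult_mono bn_le_1 t_sum_nonneg) auto
    moreover have "gc d n / (2 * real n + 1) ^ m \<le> gc d n / 1"
      using gc_nonneg[of d n] by (intro divide_left_mono) auto
    ultimately have "gc d n / (2 * real n + 1) ^ m \<le> real (Suc n) ^ d" by simp
    then show "norm (fps_nth (gser d m) n) \<le> norm (real (Suc n) ^ d)"
      using gc_nonneg[of d n] by (simp add: gser_def)
  qed
  with conv_radius_power show ?thesis by (rule order_trans)
qed

lemma gser_radius: "\<bar>x\<bar> < 1 \<Longrightarrow> ereal (norm (x :: real)) < fps_conv_radius (gser d m)"
  using less_le_trans[OF _ fps_conv_radius_gser, of "ereal \<bar>x\<bar>"] by simp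

lemma gser_sums:
  assumes "\<bar>x\<bar> < 1"
  shows "(\<lambda>n. gc d n / (2 * real n + 1) ^ m * x ^ n) sums eval_fps (gser d m) x"
  using sums_eval_fps[OF gser_radius[OF assms], of d m] by (simp add: gser_def)

lemma DERIV_gser:
  "\<bar>x\<bar> < 1 \<Longrightarrow> (eval_fps (gser d m) has_real_derivative eval_fps (fps_deriv (gser d m)) x) (at x)"
  by (intro has_field_derivative_eval_fps gser_radius)

lemma fps_conv_radius_X_mult: "fps_conv_radius f \<le> fps_conv_radius (fps_X * f :: real fps)"
  using fps_conv_radius_mult[of fps_X f] by (simp add: min_def split: if_splits)

lemma gser_deriv_radius: "\<bar>x\<bar> < 1 \<Longrightarrow> ereal (norm (x :: real)) < fps_conv_radius (fps_deriv (gser d m))"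
  using less_le_trans[OF gser_radius fps_conv_radius_deriv] .

lemma eval_XD_gser:
  assumes "\<bar>x\<bar> < 1"
  shows "eval_fps (fps_X * fps_deriv (gser d m)) x = x * eval_fps (fps_deriv (gser d m)) x"
  using gser_deriv_radius[OF assms, of d m] by (subst eval_fps_mult) auto

text \<open>The operator 1 + 2 x d/dx multiplies the n-th coefficient by 2 n + 1 and so undoes one
  division by it.\<close>

lemma eval_gser_step:
  assumes x: "\<bar>x\<bar> < 1"
  shows "eval_fps (gser d m) x =
    eval_fps (gser d (Suc m)) x + 2 * (x * eval_fps (fps_deriv (gser d (Suc m))) x)"
proof (rule sums_unique2)
  show "(\<lambda>n. fps_nth (gser d m) n * x ^ n) sums eval_fps (gser d m) x"
    by (rule sums_eval_fps[OF gser_radius[OF x]])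
  have r: "ereal (norm x) < fps_conv_radius (fps_X * fps_deriv (gser d (Suc m)))"
    using gser_deriv_radius[OF x] fps_conv_radius_X_mult by (rule less_le_trans)
  have "(\<lambda>n. fps_nth (gser d (Suc m)) n * x ^ n + 2 * (fps_nth (fps_X * fps_deriv (gser d (Suc m))) n * x ^ n))
    sums (eval_fps (gser d (Suc m)) x + 2 * (eval_fps (fps_X * fps_deriv (gser d (Suc m))) x))"
    by (intro sums_add sums_mult sums_eval_fps gser_radius x r)
  moreover have "fps_nth (gser d (Suc m)) n * x ^ n + 2 * (fps_nth (fps_X * fps_deriv (gser d (Suc m))) n * x ^ n)
      = fps_nth (gser d m) n * x ^ n" for n
  proof -
    have 1: "fps_nth (fps_X * fps_deriv (gser d (Suc m))) n = real n * fps_nth (gser d (Suc m)) n"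
      using fps_XD_nth[of "gser d (Suc m)" n] by (simp add: fps_XD_def)
    have 2: "fps_nth (gser d m) n = (2 * real n + 1) * fps_nth (gser d (Suc m)) n"
      by (simp add: gser_def add_nonneg_eq_0_iff)
    show ?thesis unfolding 1 2 by (simp only: distrib_right mult_1_left mult.assoc add.commute)
  qed
  ultimately show "(\<lambda>n. fps_nth (gser d m) n * x ^ n) sums
     (eval_fps (gser d (Suc m)) x + 2 * (x * eval_fps (fps_deriv (gser d (Suc m))) x))"
    by (simp add: eval_XD_gser[OF x])
qed

text \<open>The step of \<open>t_sum\<close> adds a term over (2 n + 1)^2, of which the recurrence
  \<open>bn_Suc\<close> cancels one factor. What remains is the coefficient of
  \<open>gser d 1\<close>.\<close>

lemma gc_Suc:
  "2 * (real n + 1) * gc (Suc d) (Suc n) - (2 * real n + 1) * gc (Suc d) n = gc d n / (2 * real n + 1)"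
  "2 * (real n + 1) * gc 0 (Suc n) - (2 * real n + 1) * gc 0 n = 0"
proof -
  define y where "y = 2 * real n + 1"
  have y: "y \<noteq> 0" by (simp add: y_def add_nonneg_eq_0_iff)
  have key: "2 * (real n + 1) * gc d' (Suc n) = y * bn n * t_sum (Suc n) (replicate d' 2)" for d'
  proof -
    have "2 * (real n + 1) * gc d' (Suc n)
        = ((2 * real n + 2) * bn (Suc n)) * t_sum (Suc n) (replicate d' 2)"
      by (simp add: gc_def distrib_left)
    then show ?thesis unfolding bn_Suc y_def .
  qed
  have t: "t_sum (Suc n) (replicate (Suc d) 2) = t_sum n (replicate (Suc d) 2) + t_sum n (replicate d 2) / y\<^sup>2"
    by (simp add: t_sum_Suc_Cons y_def)
  have "y * b * (A + B / y\<^sup>2) - y * (b * A) = b * B / y" for b A B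
    using y by (simp add: power2_eq_square field_simps)
  then show "2 * (real n + 1) * gc (Suc d) (Suc n) - (2 * real n + 1) * gc (Suc d) n = gc d n / (2 * real n + 1)"
    unfolding key unfolding t gc_def y_def[symmetric] .
  show "2 * (real n + 1) * gc 0 (Suc n) - (2 * real n + 1) * gc 0 n = 0"
    unfolding key y_def[symmetric] by (simp add: gc_def)
qed

text \<open>The recurrence \<open>gc_Suc\<close> as a differential equation; at sin^2 it says that
  \<open>psi (Suc d)\<close> has derivative \<open>phi d 1\<close> with respect to the
  angle.\<close>

lemma eval_gser_ode:
  assumes x: "\<bar>x\<bar> < 1"
  shows "2 * (1 - x) * eval_fps (fps_deriv (gser d 0)) x - eval_fps (gser d 0) x =
         (case d of 0 \<Rightarrow> 0 | Suc d' \<Rightarrow> eval_fps (gser d' 1) x)"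
proof -
  let ?f = "gser d 0" and ?D = "fps_deriv (gser d 0)"
  have r: "ereal (norm x) < fps_conv_radius (fps_X * ?D)"
    using gser_deriv_radius[OF x] fps_conv_radius_X_mult by (rule less_le_trans)
  have "(\<lambda>n. 2 * (fps_nth ?D n * x ^ n) - 2 * (fps_nth (fps_X * ?D) n * x ^ n) - fps_nth ?f n * x ^ n)
    sums (2 * eval_fps ?D x - 2 * eval_fps (fps_X * ?D) x - eval_fps ?f x)"
    by (intro sums_diff sums_mult sums_eval_fps gser_radius gser_deriv_radius x r)
  also have "2 * eval_fps ?D x - 2 * eval_fps (fps_X * ?D) x - eval_fps ?f x =
      2 * (1 - x) * eval_fps ?D x - eval_fps ?f x"
    by (simp add: eval_XD_gser[OF x] algebra_simps)
  also have "(\<lambda>n. 2 * (fps_nth ?D n * x ^ n) - 2 * (fps_nth (fps_X * ?D) n * x ^ n) - fps_nth ?f n * x ^ n)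
      = (\<lambda>n. (case d of 0 \<Rightarrow> 0 | Suc d' \<Rightarrow> gc d' n / (2 * real n + 1)) * x ^ n)"
  proof
    fix n
    have 1: "fps_nth (fps_X * ?D) n = real n * gc d n"
      using fps_XD_nth[of ?f n] by (simp add: fps_XD_def gser_def)
    have 2: "fps_nth ?D n = (real n + 1) * gc d (Suc n)" by (simp add: gser_def add.commute)
    have 3: "fps_nth ?f n = gc d n" by (simp add: gser_def)
    have "2 * (fps_nth ?D n * x ^ n) - 2 * (fps_nth (fps_X * ?D) n * x ^ n) - fps_nth ?f n * x ^ n
      = (2 * (real n + 1) * gc d (Suc n) - (2 * real n + 1) * gc d n) * x ^ n"
      unfolding 1 2 3 by (simp add: algebra_simps)
    also have "\<dots> = (case d of 0 \<Rightarrow> 0 | Suc d' \<Rightarrow> gc d' n / (2 * real n + 1)) * x ^ n"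
      using gc_Suc[of n] by (simp split: nat.splits)
    finally show "2 * (fps_nth ?D n * x ^ n) - 2 * (fps_nth (fps_X * ?D) n * x ^ n) - fps_nth ?f n * x ^ n
      = (case d of 0 \<Rightarrow> 0 | Suc d' \<Rightarrow> gc d' n / (2 * real n + 1)) * x ^ n" .
  qed
  finally have *: "(\<lambda>n. (case d of 0 \<Rightarrow> 0 | Suc d' \<Rightarrow> gc d' n / (2 * real n + 1)) * x ^ n) sums
     (2 * (1 - x) * eval_fps ?D x - eval_fps ?f x)" .
  show ?thesis
  proof (cases d)
    case 0
    from *[unfolded 0 nat.case mult_zero_left] sums_zero show ?thesis
      unfolding 0 nat.case by (rule sums_unique2)
  next
    case (Suc d')
    from *[unfolded Suc nat.case] gser_sums[OF x, of d' 1, unfolded power_one_right]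
    show ?thesis unfolding Suc nat.case by (rule sums_unique2)
  qed
qed

text \<open>The series of \<open>gc d n\<close> sin^(2n+1) / (2n+1)^m. The factor \<open>sn\<close>
  makes the step from m to m + 1 an integration against cot x dx; the factor \<open>cs\<close> in
  \<open>psi\<close> makes \<open>psi d\<close> the derivative of \<open>phi d 1\<close> in the
  angle.\<close>

definition phi :: "nat \<Rightarrow> nat \<Rightarrow> real \<Rightarrow> real" where
  "phi d m t = sn t * eval_fps (gser d m) ((sn t)\<^sup>2)"

definition psi :: "nat \<Rightarrow> real \<Rightarrow> real" where
  "psi d t = cs t * eval_fps (gser d 0) ((sn t)\<^sup>2)"

lemma phi_0 [simp]: "phi d m 0 = 0"
  by (simp add: phi_def)

lemma sn_square_abs_less_1: "0 \<le> t \<Longrightarrow> t < 1 \<Longrightarrow> \<bar>(sn t)\<^sup>2\<bar> < 1"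
  using sn_square_less_1 by simp

lemma DERIV_phi:
  assumes "0 \<le> t" "t < 1"
  shows "(phi d (Suc m) has_real_derivative cs t * wt t * eval_fps (gser d m) ((sn t)\<^sup>2)) (at t)"
proof -
  let ?x = "(sn t)\<^sup>2"
  let ?E = "eval_fps (gser d (Suc m))" and ?E' = "eval_fps (fps_deriv (gser d (Suc m))) ?x"
  have x: "\<bar>?x\<bar> < 1" using assms by (rule sn_square_abs_less_1)
  have s: "((\<lambda>t. (sn t)\<^sup>2) has_real_derivative 2 * (sn t * (cs t * wt t))) (at t)"
    by (auto intro!: derivative_eq_intros)
  have "((\<lambda>t. ?E ((sn t)\<^sup>2)) has_real_derivative ?E' * (2 * (sn t * (cs t * wt t)))) (at t)"
    by (rule DERIV_chain2[OF DERIV_gser[OF x] s])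
  then have "(phi d (Suc m) has_real_derivative
      cs t * wt t * 1 * ?E ?x + ?E' * (2 * (sn t * (cs t * wt t))) * sn t) (at t)"
    unfolding phi_def[abs_def] by (intro DERIV_mult DERIV_sn DERIV_ident)
  also have "cs t * wt t * 1 * ?E ?x + ?E' * (2 * (sn t * (cs t * wt t))) * sn t
    = cs t * wt t * eval_fps (gser d m) ?x"
    unfolding eval_gser_step[OF x, of d m] by (simp add: power2_eq_square algebra_simps)
  finally show ?thesis .
qed

lemma DERIV_psi:
  assumes "0 \<le> t" "t < 1"
  shows "(psi d has_real_derivative (case d of 0 \<Rightarrow> 0 | Suc d' \<Rightarrow> wt t * phi d' 1 t)) (at t)"
proof -
  let ?x = "(sn t)\<^sup>2"
  let ?E = "eval_fps (gser d 0)" and ?E' = "eval_fps (fps_deriv (gser d 0)) ?x"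
  have x: "\<bar>?x\<bar> < 1" using assms by (rule sn_square_abs_less_1)
  have s: "((\<lambda>t. (sn t)\<^sup>2) has_real_derivative 2 * (sn t * (cs t * wt t))) (at t)"
    by (auto intro!: derivative_eq_intros)
  have "((\<lambda>t. ?E ((sn t)\<^sup>2)) has_real_derivative ?E' * (2 * (sn t * (cs t * wt t)))) (at t)"
    by (rule DERIV_chain2[OF DERIV_gser[OF x] s])
  then have "(psi d has_real_derivative
      - (sn t * wt t * 1) * ?E ?x + ?E' * (2 * (sn t * (cs t * wt t))) * cs t) (at t)"
    unfolding psi_def[abs_def] by (intro DERIV_mult DERIV_cs DERIV_ident)
  also have "- (sn t * wt t * 1) * ?E ?x + ?E' * (2 * (sn t * (cs t * wt t))) * cs t
    = sn t * wt t * (2 * (cs t)\<^sup>2 * ?E' - ?E ?x)"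
    by (simp add: power2_eq_square algebra_simps)
  also have "\<dots> = (case d of 0 \<Rightarrow> 0 | Suc d' \<Rightarrow> wt t * phi d' 1 t)"
    unfolding cs_square eval_gser_ode[OF x] by (simp add: phi_def split: nat.splits)
  finally show ?thesis .
qed

lemma eq_from_DERIV:
  fixes f g :: "real \<Rightarrow> real"
  assumes "\<And>x. 0 \<le> x \<Longrightarrow> x < 1 \<Longrightarrow> (f has_real_derivative D x) (at x)"
    and "\<And>x. 0 \<le> x \<Longrightarrow> x < 1 \<Longrightarrow> (g has_real_derivative D x) (at x)"
    and "f 0 = g 0" "0 \<le> t" "t < 1"
  shows "f t = g t"
proof (rule eq_from_derivative[where f = f and g = g and t = t and D = D])
  show "continuous_on {0..t} f" "continuous_on {0..t} g"
    using assms(5) by (auto intro!: continuous_at_imp_continuous_on DERIV_isCont[OF assms(1)] DERIV_isCont[OF assms(2)])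
qed (use assms in \<open>auto simp: has_real_derivative_iff_has_vector_derivative\<close>)

text \<open>With \<open>sn t = sin x\<close> and \<open>2 * arctan t = x\<close> this is the expansion of the powers of the
  arcus sine: both sequences are obtained by alternately integrating \<open>psi\<close> and \<open>phi\<close>.\<close>

lemma psi_phi_eq:
  assumes "0 \<le> t" "t < 1"
  shows "psi d t = (2 * arctan t) ^ (2 * d) / fact (2 * d)"
    and "phi d 1 t = (2 * arctan t) ^ (2 * d + 1) / fact (2 * d + 1)"
proof -
  have at: "((\<lambda>t. (2 * arctan t) ^ Suc n / fact (Suc n)) has_real_derivative
      wt t * ((2 * arctan t) ^ n / fact n)) (at t)" for n t
  proof -
    have "((\<lambda>t. 2 * arctan t) has_real_derivative wt t) (at t)"
      unfolding wt_def by (auto intro!: derivative_eq_intros simp: divide_simps)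
    from DERIV_cdivide[OF DERIV_power_Suc[OF this, of n], of "fact (Suc n)"]
    show ?thesis by (simp add: mult_ac)
  qed
  have psi0: "psi d 0 = gc d 0" for d
    by (simp add: psi_def eval_fps_at_0 gser_def)
  have "(\<forall>t. 0 \<le> t \<longrightarrow> t < 1 \<longrightarrow> psi d t = (2 * arctan t) ^ (2 * d) / fact (2 * d)) \<and>
        (\<forall>t. 0 \<le> t \<longrightarrow> t < 1 \<longrightarrow> phi d 1 t = (2 * arctan t) ^ (2 * d + 1) / fact (2 * d + 1))"
  proof (induction d)
    case 0
    \<comment> \<open>This is the binomial series: 1 / cos x is the sum of b_n sin^(2n) x.\<close>
    have 1: "psi 0 t = 1" if "0 \<le> t" "t < 1" for t
      by (rule eq_from_DERIV[where D = "\<lambda>_. 0" and f = "psi 0" and g = "\<lambda>_. 1"])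
        (use DERIV_psi[of _ 0] that in \<open>auto simp: psi0 gc_def\<close>)
    have "phi 0 1 t = (2 * arctan t) ^ Suc 0 / fact (Suc 0)" if "0 \<le> t" "t < 1" for t
    proof (rule eq_from_DERIV[where f = "phi 0 1" and D = wt and t = t])
      fix x :: real assume x: "0 \<le> x" "x < 1"
      show "(phi 0 1 has_real_derivative wt x) (at x)"
      proof -
        have eq: "cs x * wt x * eval_fps (gser 0 0) ((sn x)\<^sup>2) = wt x * psi 0 x"
          by (simp add: psi_def)
        show ?thesis
          using DERIV_phi[OF x, of 0 0] unfolding eq 1[OF x] One_nat_def mult_1_right .
      qed
      show "((\<lambda>t. (2 * arctan t) ^ Suc 0 / fact (Suc 0)) has_real_derivative wt x) (at x)"
        using at[of 0 x] by simp
    qed (use that in auto)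
    with 1 show ?case by simp
  next
    case (Suc d)
    have 1: "psi (Suc d) t = (2 * arctan t) ^ Suc (2 * d + 1) / fact (Suc (2 * d + 1))"
      if "0 \<le> t" "t < 1" for t
    proof (rule eq_from_DERIV[where f = "psi (Suc d)" and D = "\<lambda>t. wt t * phi d 1 t" and t = t])
      fix x :: real assume x: "0 \<le> x" "x < 1"
      show "(psi (Suc d) has_real_derivative wt x * phi d 1 x) (at x)"
        using DERIV_psi[OF x, of "Suc d"] by simp
      show "((\<lambda>t. (2 * arctan t) ^ Suc (2 * d + 1) / fact (Suc (2 * d + 1))) has_real_derivative wt x * phi d 1 x) (at x)"
        using at[of "2 * d + 1" x] Suc x by simp
    qed (use that in \<open>auto simp: psi0 gc_def\<close>)
    have 2: "phi (Suc d) 1 t = (2 * arctan t) ^ Suc (Suc (2 * d + 1)) / fact (Suc (Suc (2 * d + 1)))"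
      if "0 \<le> t" "t < 1" for t
    proof (rule eq_from_DERIV[where f = "phi (Suc d) 1" and D = "\<lambda>t. wt t * psi (Suc d) t" and t = t])
      fix x :: real assume x: "0 \<le> x" "x < 1"
      show "(phi (Suc d) 1 has_real_derivative wt x * psi (Suc d) x) (at x)"
      proof -
        have eq: "cs x * wt x * eval_fps (gser (Suc d) 0) ((sn x)\<^sup>2) = wt x * psi (Suc d) x"
          by (simp add: psi_def)
        show ?thesis
          using DERIV_phi[OF x, of "Suc d" 0] unfolding eq One_nat_def .
      qed
      show "((\<lambda>t. (2 * arctan t) ^ Suc (Suc (2 * d + 1)) / fact (Suc (Suc (2 * d + 1)))) has_real_derivative wt x * psi (Suc d) x) (at x)"
        using at[of "Suc (2 * d + 1)" x] 1[OF x] by metis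
    qed (use that in auto)
    have "2 * Suc d = Suc (2 * d + 1)" "2 * Suc d + 1 = Suc (Suc (2 * d + 1))" by simp_all
    with 1 2 show ?case by metis
  qed
  with assms show "psi d t = (2 * arctan t) ^ (2 * d) / fact (2 * d)"
    and "phi d 1 t = (2 * arctan t) ^ (2 * d + 1) / fact (2 * d + 1)" by blast+
qed

lemma bn_sums:
  assumes "0 \<le> t" "t < 1"
  shows "(\<lambda>n. bn n * sn t ^ (2 * n)) sums (1 / cs t)"
proof -
  have "(\<lambda>n. bn n * sn t ^ (2 * n)) sums eval_fps (gser 0 0) ((sn t)\<^sup>2)"
    using gser_sums[OF sn_square_abs_less_1[OF assms], of 0 0] by (simp add: gc_def power_mult)
  moreover have "cs t * eval_fps (gser 0 0) ((sn t)\<^sup>2) = 1"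
    using psi_phi_eq(1)[OF assms, of 0] by (simp add: psi_def)
  then have "eval_fps (gser 0 0) ((sn t)\<^sup>2) = 1 / cs t"
    using cs_pos[OF assms] by (simp add: field_simps)
  ultimately show ?thesis by simp
qed

text \<open>The sign cancels \<i>^(2d) in the power of \<open>atan_fps\<close>, which represents
  \<i> x. The three letters of the step add up to cot x dx = (1/t - 2t/(1 + t^2)) dt. Level m
  represents \<open>phi d (Suc m)\<close>.\<close>

primrec phi_fps :: "nat \<Rightarrow> nat \<Rightarrow> complex fps" where
  "phi_fps d 0 = fps_const (of_rat ((- 1) ^ d * (1 / fact (2 * d + 1)))) * atan_fps ^ (2 * d + 1)"
| "phi_fps d (Suc m) = pint 0 (phi_fps d m) + (pint \<i> (phi_fps d m) + pint (- \<i>) (phi_fps d m))"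

lemma polylog_phi: "polylog False (2 * d + m + 1) (phi_fps d m)"
proof (induction m)
  case 0
  have "polylog False (2 * d + 1) (atan_fps ^ (2 * d + 1))"
    using polylog_power[OF polylog_weaken[OF polylog_atan], of "2 * d + 1"] by (simp only: mult_1_right)
  from polylog.scale[OF this] show ?case by simp
next
  case (Suc m)
  have "polylog False (Suc (2 * d + m + 1)) (phi_fps d (Suc m))"
    unfolding phi_fps.simps by (intro polylog.add polylog.integ[OF Suc]) auto
  then show ?case by simp
qed

text \<open>\<open>phi_fps d m\<close> carries a factor \<open>\<i>\<close> so that its coefficients are rational combinations
  of those of polylogarithms.\<close>

lemma pval_phi: "0 \<le> t \<Longrightarrow> t < 1 \<Longrightarrow> pval (phi_fps d m) t = \<i> * of_real (phi d (Suc m) t)"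
proof (induction m arbitrary: t)
  case 0
  then have abs: "\<bar>t\<bar> < 1" by simp
  have i: "\<i> ^ (2 * d + 1) = \<i> * (- 1) ^ d" by (simp add: power_mult)
  have "pval (phi_fps d 0) t = of_rat ((- 1) ^ d * (1 / fact (2 * d + 1))) * (\<i> * of_real (2 * arctan t)) ^ (2 * d + 1)"
    unfolding phi_fps.simps pval_scale[OF polylog_power[OF polylog_atan] abs]
      pval_power[OF polylog_atan abs] pval_atan[OF 0] ..
  also have "(\<i> * of_real (2 * arctan t)) ^ (2 * d + 1) = \<i> * (- 1) ^ d * of_real (2 * arctan t) ^ (2 * d + 1)"
    unfolding power_mult_distrib i ..
  also have "of_rat ((- 1) ^ d * (1 / fact (2 * d + 1))) = complex_of_real ((- 1) ^ d * (1 / fact (2 * d + 1)))"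
    unfolding of_rat_mult of_real_mult of_rat_inverse_fact by (cases "even d") (simp_all add: of_rat_minus)
  also have "\<dots> * (\<i> * (- 1) ^ d * of_real (2 * arctan t) ^ (2 * d + 1))
     = \<i> * of_real (((- 1) ^ d * (- 1) ^ d) * ((2 * arctan t) ^ (2 * d + 1) / fact (2 * d + 1)))"
    by (simp only: of_real_mult of_real_divide of_real_power of_real_minus of_real_1 times_divide_eq_right times_divide_eq_left mult_ac mult_1_left)
  also have "(- 1) ^ d * (- 1) ^ d = (1 :: real)"
    by (simp flip: power_mult_distrib)
  finally show ?case using psi_phi_eq(2)[OF 0] by (simp only: mult_1_left One_nat_def)
next
  case (Suc m)
  let ?f = "phi_fps d m"
  define D where "D = (\<lambda>t. \<i> * of_real (cs t * wt t * eval_fps (gser d (Suc m)) ((sn t)\<^sup>2)))"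
  have pl: "polylog False (Suc (2 * d + m + 1)) (pint 0 ?f)"
    "polylog False (Suc (2 * d + m + 1)) (pint \<i> ?f)"
    "polylog False (Suc (2 * d + m + 1)) (pint (- \<i>) ?f)"
    by (rule polylog.integ[OF polylog_phi]; simp)+
  show ?case
  proof (rule eq_from_derivative[where f = "pval (phi_fps d (Suc m))"
       and g = "\<lambda>t. \<i> * of_real (phi d (Suc (Suc m)) t)" and t = t and D = D])
    show "continuous_on {0..t} (pval (phi_fps d (Suc m)))"
      using polylog_phi Suc.prems(2) by (rule continuous_on_pval)
    have "isCont (phi d (Suc (Suc m))) x" if "x \<in> {0..t}" for x
      using DERIV_phi[of x] that Suc.prems by (intro DERIV_isCont) auto
    then show "continuous_on {0..t} (\<lambda>t. \<i> * of_real (phi d (Suc (Suc m)) t))"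
      by (intro continuous_on_mult continuous_on_const continuous_on_of_real continuous_at_imp_continuous_on) auto
    fix x assume x: "0 < x" "x < t"
    then have x1: "0 \<le> x" "x < 1" using Suc.prems by auto
    show "((\<lambda>t. \<i> * of_real (phi d (Suc (Suc m)) t)) has_vector_derivative D x) (at x)"
      unfolding D_def
      by (intro has_vector_derivative_mult_right has_vector_derivative_of_real DERIV_phi x1)
    have "((\<lambda>x. pval (pint 0 ?f) x + (pval (pint \<i> ?f) x + pval (pint (- \<i>) ?f) x)) has_vector_derivative
       form 0 x * pval ?f x + (form \<i> x * pval ?f x + form (- \<i>) x * pval ?f x)) (at x)"
      using x(1) x1 by (intro has_vector_derivative_add pval_pint_has_vector_derivative[OF polylog_phi]) auto
    also have "form 0 x * pval ?f x + (form \<i> x * pval ?f x + form (- \<i>) x * pval ?f x) = D x"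
    proof -
      have "form 0 x + (form \<i> x + form (- \<i>) x) = of_real (1 / x - sn x)"
        unfolding form_i_add by (simp add: form_def)
      moreover have "(1 / x - sn x) * sn x = cs x * wt x"
      proof -
        have "(1 / x - sn x) * sn x = sn x / x - (sn x)\<^sup>2" by (simp add: algebra_simps power2_eq_square)
        also have "sn x / x = wt x" using x(1) by (simp add: sn_def wt_def)
        also have "wt x - (sn x)\<^sup>2 = cs x * wt x"
          using cs_square[of x] by (simp add: wt_eq algebra_simps power2_eq_square)
        finally show ?thesis .
      qed
      then have "(1 / x - sn x) * phi d (Suc m) x = cs x * wt x * eval_fps (gser d (Suc m)) ((sn x)\<^sup>2)"
        by (simp add: phi_def)
      ultimately show ?thesis
        unfolding D_def Suc.IH[OF x1]
        by (metis (no_types, opaque_lifting) distrib_right mult.left_commute of_real_mult)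
    qed
    finally show "(pval (phi_fps d (Suc m)) has_vector_derivative D x) (at x)"
      by (rule has_vector_derivative_transform_within_open[of _ _ _ "{0<..<1}"])
        (use x1 x(1) pl in \<open>auto simp: pval_add[OF _ polylog.add] pval_add\<close>)
  qed (use Suc.prems in \<open>auto simp: pval_0\<close>)
qed


section \<open>Integrals of powers of sine, cosine and the logarithm of cosine\<close>

text \<open>The boundary terms of the integrations by parts below contain this product: the zero of
  the cosine at t = 1 beats every power of the logarithm.\<close>

lemma continuous_on_cs_lamp: "continuous_on {0..1} (\<lambda>t. cs t * lamp j t)"
proof (rule continuous_on_IccI)
  have cont: "isCont (\<lambda>t. cs t * lamp j t) t" if "0 \<le> t" "t < 1" for t
  proof -
    have "isCont lam t" using DERIV_lam[OF that] by (rule DERIV_isCont)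
    moreover have "isCont cs t" using DERIV_cs[OF DERIV_ident] by (rule DERIV_isCont)
    ultimately show ?thesis unfolding lamp_def by (intro continuous_intros) auto
  qed
  show "((\<lambda>t. cs t * lamp j t) \<longlongrightarrow> cs 0 * lamp j 0) (at_right 0)"
    using cont[of 0] by (simp add: isCont_def tendsto_within_subset[OF _ subset_UNIV])
  show "(\<lambda>t. cs t * lamp j t) \<midarrow>x\<rightarrow> cs x * lamp j x" if "0 < x" "x < 1" for x
    using cont[of x] that by (simp add: isCont_def)
  have "isCont cs 1" using DERIV_cs[OF DERIV_ident] by (rule DERIV_isCont)
  then have "(cs \<longlongrightarrow> 0) (at_left 1)"
    by (simp add: isCont_def tendsto_within_subset[OF _ subset_UNIV])
  then have "filterlim cs (at_right 0) (at_left 1)"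
    unfolding filterlim_at using eventually_at_left_1[of "\<lambda>t. cs t > 0"] cs_pos
    by (auto elim: eventually_mono)
  then have "filterlim (\<lambda>t. ln (cs t)) at_bot (at_left 1)"
    by (rule filterlim_compose[OF ln_at_0])
  then have y: "filterlim (\<lambda>t. - ln (cs t)) at_top (at_left 1)"
    by (simp add: filterlim_uminus_at_bot)
  \<comment> \<open>With y = -ln (cos x), the product is a constant times y^j e^(-y).\<close>
  have "((\<lambda>t. 2 ^ j / fact j * ((- ln (cs t)) ^ j / exp (- ln (cs t)))) \<longlongrightarrow> 2 ^ j / fact j * 0) (at_left 1)"
    by (intro tendsto_mult_left filterlim_compose[OF tendsto_power_div_exp_0 y])
  moreover have "\<forall>\<^sub>F t in at_left 1. 2 ^ j / fact j * ((- ln (cs t)) ^ j / exp (- ln (cs t))) = cs t * lamp j t"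
  proof (rule eventually_at_left_1)
    fix t :: real assume "0 < t" "t < 1"
    then have "exp (- ln (cs t)) = 1 / cs t"
      using cs_pos[of t] by (simp add: exp_minus divide_inverse)
    moreover have "lam t ^ j = 2 ^ j * (- ln (cs t)) ^ j"
      by (simp add: lam_def flip: power_mult_distrib)
    ultimately show "2 ^ j / fact j * ((- ln (cs t)) ^ j / exp (- ln (cs t))) = cs t * lamp j t"
      by (simp add: lamp_def)
  qed
  ultimately have "((\<lambda>t. cs t * lamp j t) \<longlongrightarrow> 2 ^ j / fact j * 0) (at_left 1)"
    by (rule Lim_transform_eventually)
  then show "((\<lambda>t. cs t * lamp j t) \<longlongrightarrow> cs 1 * lamp j 1) (at_left 1)" by simp
qed simp

text \<open>A shift to j - 1 with value 0 below index 0, so that the recursions in j start uniformly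
  at j = 0.\<close>

definition prev :: "(nat \<Rightarrow> real) \<Rightarrow> nat \<Rightarrow> real" where
  "prev f j = (case j of 0 \<Rightarrow> 0 | Suc k \<Rightarrow> f k)"

lemma prev_0 [simp]: "prev f 0 = 0" and prev_Suc [simp]: "prev f (Suc k) = f k"
  by (simp_all add: prev_def)

lemma DERIV_lamp:
  assumes "0 \<le> t" "t < 1"
  shows "(lamp j has_real_derivative 2 * (sn t / cs t) * wt t * prev (\<lambda>k. lamp k t) j) (at t)"
proof (cases j)
  case 0
  have "lamp 0 = (\<lambda>_. 1)" by auto
  with 0 show ?thesis by simp
next
  case (Suc k)
  with DERIV_lamp_Suc[OF assms] show ?thesis by simp
qed

lemma boundary_integral:
  assumes "continuous_on {0..1} G"
    and "\<And>t. 0 < t \<Longrightarrow> t < 1 \<Longrightarrow> (G has_real_derivative g t) (at t)"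
  shows "(g has_integral (G 1 - G 0)) {0<..<1}"
proof -
  have "(g has_integral (G 1 - G 0)) {0..1}"
    using assms by (intro fundamental_theorem_of_calculus_interior)
      (auto simp: has_real_derivative_iff_has_vector_derivative)
  then show ?thesis by (simp add: has_integral_Icc_iff_Ioo)
qed

definition zs :: "nat \<Rightarrow> nat \<Rightarrow> real" where "zs n k = zeta_star_sum n (replicate k 1)"

lemma zs_0 [simp]: "zs n 0 = 1"
  by (simp add: zs_def)

lemma zs_0_left: "zs 0 k = (if k = 0 then 1 else 0)"
  by (cases k) (simp_all add: zs_def)

lemma zs_nonneg: "zs n k \<ge> 0"
  by (simp add: zs_def zeta_star_sum_nonneg)

lemma zs_Suc: "zs (Suc n) k = zs n k + prev (zs (Suc n)) k / (real n + 1)"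
  by (cases k) (simp_all add: zs_def zeta_star_sum_Suc_Cons add.commute)

section \<open>Moments of the divided powers of \<lambda> against powers of sine\<close>

definition Iv :: "nat \<Rightarrow> real" where
  "Iv j = integral {0<..<1} (\<lambda>t. wt t * lamp j t)"

text \<open>Transfers existence as well as value from complex polylogarithm integrals to real
  integrands, which monotone convergence requires later.\<close>

lemma i_integral_imp_real:
  assumes "((\<lambda>t. \<i> * complex_of_real (g t)) has_integral v) S"
  obtains x where "v = \<i> * of_real x" "(g has_integral x) S"
proof
  have "((\<lambda>t. Re (\<i> * complex_of_real (g t))) has_integral Re v) S"
    using assms by (rule has_integral_Re)
  then have "((\<lambda>t. 0) has_integral Re v) S" by simp
  then have "Re v = 0" by (simp add: has_integral_0_eq)
  then show "v = \<i> * of_real (Im v)" by (simp add: complex_eq_iff)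
  have "((\<lambda>t. Im (\<i> * complex_of_real (g t))) has_integral Im v) S"
    using assms by (rule has_integral_Im)
  then show "(g has_integral Im v) S" by simp
qed

lemma real_integral_imp_real:
  assumes "((\<lambda>t. complex_of_real (g t)) has_integral v) S"
  obtains x where "v = of_real x" "(g has_integral x) S"
proof
  have "((\<lambda>t. Im (complex_of_real (g t))) has_integral Im v) S"
    using assms by (rule has_integral_Im)
  then have "((\<lambda>t. 0) has_integral Im v) S" by simp
  then have "Im v = 0" by (simp add: has_integral_0_eq)
  then show "v = of_real (Re v)" by (simp add: complex_eq_iff)
  have "((\<lambda>t. Re (complex_of_real (g t))) has_integral Re v) S"
    using assms by (rule has_integral_Re)
  then show "(g has_integral Re v) S" by simp
qed

text \<open>Only existence is taken from the polylogarithms here: the value u - v would show that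
  \<open>\<i> * Iv j\<close> has weight j + 1, not that \<open>Iv j / pi\<close> has weight
  j.\<close>

lemma Iv_integral: "((\<lambda>t. wt t * lamp j t) has_integral Iv j) {0<..<1}"
proof -
  obtain u v where "((\<lambda>t. form \<i> t * pval (lamp_fps j) t) has_integral u) {0<..<1}"
      "((\<lambda>t. form (- \<i>) t * pval (lamp_fps j) t) has_integral v) {0<..<1}"
    using form_integral[OF polylog_lamp[of j], of \<i>] form_integral[OF polylog_lamp[of j], of "- \<i>"]
    by (metis fourth_roots)
  then have "((\<lambda>t. form \<i> t * pval (lamp_fps j) t - form (- \<i>) t * pval (lamp_fps j) t) has_integral (u - v)) {0<..<1}"
    by (rule has_integral_diff)
  then have "((\<lambda>t. \<i> * complex_of_real (wt t * lamp j t)) has_integral (u - v)) {0<..<1}"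
    by (rule has_integral_eq[rotated])
      (auto simp: pval_lamp simp flip: form_i_diff left_diff_distrib mult.assoc)
  then obtain x where "((\<lambda>t. wt t * lamp j t) has_integral x) {0<..<1}"
    by (rule i_integral_imp_real)
  then show ?thesis unfolding Iv_def by (simp add: integral_unique)
qed

lemma Iv_nonneg: "Iv j \<ge> 0"
  by (rule has_integral_nonneg[OF Iv_integral]) (simp add: less_imp_le[OF wt_pos] lamp_nonneg)

lemma Iv_0: "Iv 0 = pi / 2"
proof -
  have "(wt has_integral (2 * arctan 1 - 2 * arctan 0)) {0<..<1}"
    by (rule boundary_integral)
      (auto simp: wt_def divide_simps intro!: derivative_eq_intros continuous_intros)
  then have "(wt has_integral (pi / 2)) {0<..<1}" by (simp add: arctan_one)
  moreover have "(wt has_integral Iv 0) {0<..<1}" using Iv_integral[of 0] by simp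
  ultimately show ?thesis by (metis has_integral_unique)
qed

text \<open>Origin of the formula: the sum of y^j \<open>lamp j\<close> is cos^(-2y), and the Beta
  integral of sin^(2n) cos^(-2y) is the one for n = 0 times the product over k from 1 to n of (k -
  1/2) / (k - y). This product is b_n times the generating function of \<open>zs n\<close>, whence
  the convolution.\<close>

definition Sv :: "nat \<Rightarrow> nat \<Rightarrow> real" where
  "Sv n j = (\<Sum>i\<le>j. Iv i * (bn n * zs n (j - i)))"

lemma Sv_Suc: "(2 * real n + 2) * Sv (Suc n) j = (2 * real n + 1) * Sv n j + 2 * prev (Sv (Suc n)) j"
proof -
  have a: "(2 * real n + 2) * (bn (Suc n) * zs (Suc n) k) =
      (2 * real n + 1) * (bn n * zs n k) + 2 * prev (\<lambda>l. bn (Suc n) * zs (Suc n) l) k" for k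
  proof -
    have "(2 * x + 2) * (b * (z + p / (x + 1))) = ((2 * x + 2) * b) * z + 2 * (b * p)"
      if "x + 1 \<noteq> 0" for x b z p :: real
      using that by (simp add: field_simps)
    from this[of "real n" "bn (Suc n)" "zs n k" "prev (zs (Suc n)) k"]
    have "(2 * real n + 2) * (bn (Suc n) * zs (Suc n) k) =
        ((2 * real n + 2) * bn (Suc n)) * zs n k + 2 * (bn (Suc n) * prev (zs (Suc n)) k)"
      unfolding zs_Suc[of n k] by simp
    also have "bn (Suc n) * prev (zs (Suc n)) k = prev (\<lambda>l. bn (Suc n) * zs (Suc n) l) k"
      by (cases k) auto
    finally show ?thesis unfolding bn_Suc by (simp only: mult.assoc)
  qed
  have p: "(\<Sum>i\<le>j. Iv i * prev (\<lambda>l. bn (Suc n) * zs (Suc n) l) (j - i)) = prev (Sv (Suc n)) j"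
    by (cases j) (auto simp: Sv_def Suc_diff_le intro!: sum.cong)
  have "(2 * real n + 2) * Sv (Suc n) j
      = (\<Sum>i\<le>j. Iv i * ((2 * real n + 2) * (bn (Suc n) * zs (Suc n) (j - i))))"
    unfolding Sv_def sum_distrib_left by (simp only: mult.left_commute)
  also have "\<dots> = (2 * real n + 1) * Sv n j
      + 2 * (\<Sum>i\<le>j. Iv i * prev (\<lambda>l. bn (Suc n) * zs (Suc n) l) (j - i))"
    unfolding a Sv_def sum_distrib_left distrib_left sum.distrib by (simp only: mult.left_commute)
  finally show ?thesis unfolding p .
qed

text \<open>The function \<open>G\<close> below vanishes at both ends; integrating its derivative
  and replacing cos^2 by 1 - sin^2 gives the recurrence \<open>Sv_Suc\<close>.\<close>

lemma sn_power_integral: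
  "((\<lambda>t. sn t ^ (2 * n) * wt t * lamp j t) has_integral Sv n j) {0<..<1}"
proof (induction n arbitrary: j)
  case 0
  have "Sv 0 j = (\<Sum>i\<in>{j}. Iv i)"
    unfolding Sv_def by (rule sum.mono_neutral_cong_right) (auto simp: zs_0_left)
  then show ?case using Iv_integral[of j] by simp
next
  case (Suc n)
  have step: "((\<lambda>t. sn t ^ (2 * Suc n) * wt t * lamp j t) has_integral Sv (Suc n) j) {0<..<1}"
    if prev: "((\<lambda>t. sn t ^ (2 * Suc n) * wt t * prev (\<lambda>k. lamp k t) j) has_integral prev (Sv (Suc n)) j) {0<..<1}"
    for j
  proof -
    define G where "G = (\<lambda>t. sn t ^ Suc (2 * n) * (cs t * lamp j t))"
    define g where "g = (\<lambda>t. (2 * real n + 1) * (sn t ^ (2 * n) * wt t * lamp j t)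
        - (2 * real n + 2) * (sn t ^ (2 * Suc n) * wt t * lamp j t)
        + 2 * (sn t ^ (2 * Suc n) * wt t * prev (\<lambda>k. lamp k t) j))"
    have "(g has_integral (G 1 - G 0)) {0<..<1}"
    proof (rule boundary_integral)
      show "continuous_on {0..1} G"
        unfolding G_def by (intro continuous_on_mult continuous_on_power continuous_on_sn continuous_on_cs_lamp)
      fix t :: real assume t: "0 < t" "t < 1"
      then have t': "0 \<le> t" by simp
      let ?p = "prev (\<lambda>k. lamp k t) j"
      have 1: "((\<lambda>t. sn t ^ Suc (2 * n)) has_real_derivative (1 + real (2 * n)) * (cs t * wt t * 1 * sn t ^ (2 * n))) (at t)"
        by (rule DERIV_power_Suc[OF DERIV_sn[OF DERIV_ident]])
      have "(G has_real_derivative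
        (1 + real (2 * n)) * (cs t * wt t * 1 * sn t ^ (2 * n)) * (cs t * lamp j t)
        + (- (sn t * wt t * 1) * lamp j t + 2 * (sn t / cs t) * wt t * ?p * cs t) * sn t ^ Suc (2 * n)) (at t)"
        unfolding G_def by (intro DERIV_mult 1 DERIV_cs[OF DERIV_ident] DERIV_lamp t' t)
      also have "(1 + real (2 * n)) * (cs t * wt t * 1 * sn t ^ (2 * n)) * (cs t * lamp j t)
        + (- (sn t * wt t * 1) * lamp j t + 2 * (sn t / cs t) * wt t * ?p * cs t) * sn t ^ Suc (2 * n) = g t"
      proof -
        have c: "2 * (sn t / cs t) * wt t * ?p * cs t = 2 * sn t * wt t * ?p"
          using cs_pos[OF t' t(2)] by simp
        have "(1 + 2 * x) * (c * w * 1 * P) * (c * l) + (- (s * w * 1) * l + 2 * s * w * p) * (s * P)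
          = (2 * x + 1) * (P * w * l) - (2 * x + 2) * (s\<^sup>2 * P * w * l) + 2 * (s\<^sup>2 * P * w * p)"
          if "c\<^sup>2 = 1 - s\<^sup>2" for x c w P l s p :: real
          using that by algebra
        from this[OF cs_square] show ?thesis
          unfolding c g_def by (simp add: power2_eq_square mult.assoc)
      qed
      finally show "(G has_real_derivative g t) (at t)" .
    qed
    moreover have "G 1 - G 0 = 0" by (simp add: G_def)
    ultimately have "(g has_integral 0) {0<..<1}" by simp
    then have "((\<lambda>t. ((2 * real n + 1) * (sn t ^ (2 * n) * wt t * lamp j t)
        + 2 * (sn t ^ (2 * Suc n) * wt t * prev (\<lambda>k. lamp k t) j) - g t) / (2 * real n + 2))
        has_integral ((2 * real n + 1) * Sv n j + 2 * prev (Sv (Suc n)) j - 0) / (2 * real n + 2)) {0<..<1}"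
      by (intro has_integral_divide has_integral_diff has_integral_add has_integral_mult_right Suc.IH prev)
    moreover have "2 * real n + 2 \<noteq> 0" by (simp add: add_nonneg_eq_0_iff)
    then have "((2 * real n + 1) * Sv n j + 2 * prev (Sv (Suc n)) j - 0) / (2 * real n + 2) = Sv (Suc n) j"
      unfolding diff_0_right Sv_Suc[symmetric] by simp
    moreover have "((2 * real n + 1) * (sn t ^ (2 * n) * wt t * lamp j t)
        + 2 * (sn t ^ (2 * Suc n) * wt t * prev (\<lambda>k. lamp k t) j) - g t) / (2 * real n + 2)
        = sn t ^ (2 * Suc n) * wt t * lamp j t" for t
    proof -
      have "(A + B - (A - C * h + B)) / C = h" if "C \<noteq> 0" for A B C h :: real
        using that by simp
      from this[OF \<open>2 * real n + 2 \<noteq> 0\<close>] show ?thesis unfolding g_def .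
    qed
    ultimately show ?thesis by (simp only:)
  qed
  show ?case
  \<comment> \<open>The recurrence for n + 1 also refers to n + 1 at j - 1, hence a second induction
    inside the first.\<close>
  proof (induction j)
    case 0
    show ?case by (rule step) simp
  next
    case (Suc k)
    show ?case by (rule step) (use Suc.IH in simp)
  qed
qed

text \<open>With u = sin^2 x this is n times the integral of u^(n-1) (-ln (1 - u))^k / k! over
  [0, 1], which is free of \<open>pi\<close>. The correction accounts for n = 0, where the prefactor
  kills the integral although \<open>zs 0 0\<close> is 1.\<close>

lemma sn_power_cs_integral:
  "((\<lambda>t. real n * (2 * sn t ^ (2 * n - 1)) * (cs t * wt t * lamp k t)) has_integral
      (zs n k - (if n = 0 \<and> k = 0 then 1 else 0))) {0<..<1}"
proof (induction n arbitrary: k)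
  case 0
  then show ?case by (simp add: zs_0_left)
next
  case (Suc n)
  have step: "((\<lambda>t. real (Suc n) * (2 * sn t ^ Suc (2 * n)) * (cs t * wt t * lamp k t)) has_integral zs (Suc n) k) {0<..<1}"
    if prev: "((\<lambda>t. real (Suc n) * (2 * sn t ^ Suc (2 * n)) * (cs t * wt t * prev (\<lambda>k. lamp k t) k)) has_integral
        prev (zs (Suc n)) k) {0<..<1}" for k
  proof -
    define G where "G = (\<lambda>t. sn t ^ (2 * n) * (cs t * (cs t * lamp k t)))"
    define f where "f = (\<lambda>t. real n * (2 * sn t ^ (2 * n - 1)) * (cs t * wt t * lamp k t))"
    define h where "h = (\<lambda>t. real (Suc n) * (2 * sn t ^ Suc (2 * n)) * (cs t * wt t * lamp k t))"
    define q where "q = (\<lambda>t. real (Suc n) * (2 * sn t ^ Suc (2 * n)) * (cs t * wt t * prev (\<lambda>k. lamp k t) k))"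
    define g where "g = (\<lambda>t. f t - h t + q t / real (Suc n))"
    have "(g has_integral (G 1 - G 0)) {0<..<1}"
    proof (rule boundary_integral)
      show "continuous_on {0..1} G"
        unfolding G_def
        by (intro continuous_on_mult continuous_on_power continuous_on_sn continuous_on_cs continuous_on_cs_lamp)
      fix t :: real assume t: "0 < t" "t < 1"
      then have t': "0 \<le> t" by simp
      let ?p = "prev (\<lambda>k. lamp k t) k"
      have 1: "((\<lambda>t. sn t ^ (2 * n)) has_real_derivative real (2 * n) * (cs t * wt t * 1 * sn t ^ (2 * n - Suc 0))) (at t)"
        by (rule DERIV_power[OF DERIV_sn[OF DERIV_ident]])
      have "(G has_real_derivative
        real (2 * n) * (cs t * wt t * 1 * sn t ^ (2 * n - Suc 0)) * (cs t * (cs t * lamp k t))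
        + (- (sn t * wt t * 1) * (cs t * lamp k t)
           + (- (sn t * wt t * 1) * lamp k t + 2 * (sn t / cs t) * wt t * ?p * cs t) * cs t) * sn t ^ (2 * n)) (at t)"
        unfolding G_def by (intro DERIV_mult 1 DERIV_cs[OF DERIV_ident] DERIV_lamp t' t)
      also have "real (2 * n) * (cs t * wt t * 1 * sn t ^ (2 * n - Suc 0)) * (cs t * (cs t * lamp k t))
        + (- (sn t * wt t * 1) * (cs t * lamp k t)
           + (- (sn t * wt t * 1) * lamp k t + 2 * (sn t / cs t) * wt t * ?p * cs t) * cs t) * sn t ^ (2 * n) = g t"
      proof -
        have c: "2 * (sn t / cs t) * wt t * ?p * cs t = 2 * sn t * wt t * ?p"
          using cs_pos[OF t' t(2)] by simp
        have P: "real n * sn t ^ (2 * n) = real n * (sn t * sn t ^ (2 * n - 1))"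
          by (cases n) auto
        have alg: "2 * x * (c * w * 1 * Q) * (c * (c * l)) + (- (s * w * 1) * (c * l)
           + (- (s * w * 1) * l + 2 * s * w * p) * c) * P
          = x * (2 * Q) * (c * w * l) - (x + 1) * (2 * (s * P)) * (c * w * l) + 2 * (s * P) * (c * w * p)"
          if "c\<^sup>2 = 1 - s\<^sup>2" "x * P = x * (s * Q)" for x c w P Q l s p :: real
          using that by algebra
        have "q t / real (Suc n) = 2 * (sn t * sn t ^ (2 * n)) * (cs t * wt t * ?p)"
          by (simp add: q_def del: of_nat_Suc)
        moreover have "h t = (real n + 1) * (2 * (sn t * sn t ^ (2 * n))) * (cs t * wt t * lamp k t)"
          by (simp add: h_def add.commute)
        ultimately show ?thesis
          using alg[OF cs_square[of t] P, of "wt t" "lamp k t" ?p]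
          unfolding c g_def f_def by simp
      qed
      finally show "(G has_real_derivative g t) (at t)" .
    qed
    \<comment> \<open>The boundary value at 0 is nonzero only for n = k = 0 and cancels the
      correction in the induction hypothesis.\<close>
    moreover have "G 1 - G 0 = - (if n = 0 \<and> k = 0 then 1 else 0)"
      by (cases k) (simp_all add: G_def lamp_def)
    ultimately have "((\<lambda>t. f t + q t / real (Suc n) - g t) has_integral
        ((zs n k - (if n = 0 \<and> k = 0 then 1 else 0)) + prev (zs (Suc n)) k / real (Suc n)
         - (- (if n = 0 \<and> k = 0 then 1 else 0)))) {0<..<1}"
      unfolding f_def q_def using Suc.IH prev
      by (intro has_integral_diff has_integral_add has_integral_divide) simp_all
    moreover have "f t + q t / real (Suc n) - g t = h t" for t by (simp add: g_def)
    moreover have "(zs n k - (if n = 0 \<and> k = 0 then 1 else 0)) + prev (zs (Suc n)) k / real (Suc n)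
         - (- (if n = 0 \<and> k = 0 then 1 else 0)) = zs (Suc n) k"
      unfolding zs_Suc[of n k] by (simp add: add.commute)
    ultimately show ?thesis unfolding h_def by (simp only:)
  qed
  have "((\<lambda>t. real (Suc n) * (2 * sn t ^ Suc (2 * n)) * (cs t * wt t * lamp k t)) has_integral zs (Suc n) k) {0<..<1}"
  proof (induction k)
    case 0
    show ?case by (rule step) simp
  next
    case (Suc k)
    show ?case by (rule step) (use Suc.IH in simp)
  qed
  then show ?case by simp
qed


section \<open>Termwise integration\<close>

text \<open>Monotone convergence; the known integral of the limit bounds the partial sums.\<close>

lemma sums_has_integral:
  fixes f :: "nat \<Rightarrow> real \<Rightarrow> real"
  assumes int: "\<And>n. (f n has_integral x n) S"
    and nonneg: "\<And>n t. t \<in> S \<Longrightarrow> 0 \<le> f n t"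
    and sums: "\<And>t. t \<in> S \<Longrightarrow> (\<lambda>n. f n t) sums g t"
    and g: "(g has_integral X) S"
  shows "x sums X"
proof -
  define F where "F = (\<lambda>N t. \<Sum>n<N. f n t)"
  have F: "(F N has_integral (\<Sum>n<N. x n)) S" for N
    unfolding F_def by (intro has_integral_sum int) auto
  have le: "F N t \<le> g t" if "t \<in> S" for N t
    using sum_le_suminf[of "\<lambda>n. f n t" "{..<N}"] sums[OF that] nonneg[OF that]
    by (simp add: F_def sums_iff)
  have "bounded (range (\<lambda>N. integral S (F N)))"
  proof (rule boundedI)
    fix y assume "y \<in> range (\<lambda>N. integral S (F N))"
    then obtain N where y: "y = (\<Sum>n<N. x n)" using F integral_unique by blast
    have "0 \<le> y" unfolding y
      by (rule has_integral_nonneg[OF F]) (auto simp: F_def intro!: sum_nonneg nonneg)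
    moreover have "y \<le> X" unfolding y by (rule has_integral_le[OF F g le])
    ultimately show "norm y \<le> X" by simp
  qed
  then have "g integrable_on S \<and> (\<lambda>N. integral S (F N)) \<longlonglongrightarrow> integral S g"
    using F sums nonneg
    by (intro monotone_convergence_increasing) (auto simp: F_def sums_def integrable_on_def)
  then show ?thesis
    using integral_unique[OF F] integral_unique[OF g] by (simp add: sums_def)
qed

section \<open>The series E_k and the weights of the normalized integrals\<close>

definition Ev :: "nat \<Rightarrow> real" where
  "Ev k = (\<Sum>n. bn (Suc n) * (zs (Suc n) k / real (Suc n)))"

text \<open>Summing the moments of \<open>sn_power_cs_integral\<close> against b_n / n produces 2 (1
  / cos x - 1) cos x / sin x = 2 tan (x/2), and tan (x/2) dx is \<open>sn t\<close> dt. Only the sum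
  of the letters \<i> and -\<i> occurs, so the value is real without an extra factor \<i>.\<close>

lemma Ev:
  shows "(\<lambda>n. bn (Suc n) * (zs (Suc n) k / real (Suc n))) sums Ev k"
    and "limval (Suc k) (of_real (Ev k))"
proof -
  obtain u v where uv: "limval (Suc k) u" "limval (Suc k) v"
    and int: "((\<lambda>t. form \<i> t * pval (lamp_fps k) t) has_integral u) {0<..<1}"
      "((\<lambda>t. form (- \<i>) t * pval (lamp_fps k) t) has_integral v) {0<..<1}"
    using form_integral[OF polylog_lamp[of k], of \<i>] form_integral[OF polylog_lamp[of k], of "- \<i>"]
    by (metis fourth_roots)
  have "((\<lambda>t. of_rat (- 2) * (form \<i> t * pval (lamp_fps k) t + form (- \<i>) t * pval (lamp_fps k) t))
      has_integral (of_rat (- 2) * (u + v))) {0<..<1}"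
    by (intro has_integral_mult_right has_integral_add int)
  then have "((\<lambda>t. complex_of_real (2 * sn t * lamp k t)) has_integral (of_rat (- 2) * (u + v))) {0<..<1}"
  proof (rule has_integral_eq[rotated])
    fix t :: real assume "t \<in> {0<..<1}"
    then have "pval (lamp_fps k) t = of_real (lamp k t)" by (simp add: pval_lamp)
    moreover have "form \<i> t * x + form (- \<i>) t * x = - of_real (sn t) * x" for x
      unfolding distrib_right[symmetric] form_i_add ..
    ultimately show "of_rat (- 2) * (form \<i> t * pval (lamp_fps k) t + form (- \<i>) t * pval (lamp_fps k) t)
        = complex_of_real (2 * sn t * lamp k t)"
      by (simp add: of_rat_minus)
  qed
  then obtain e where e: "of_rat (- 2) * (u + v) = complex_of_real e"
      "((\<lambda>t. 2 * sn t * lamp k t) has_integral e) {0<..<1}"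
    by (rule real_integral_imp_real)
  have sums: "(\<lambda>n. bn (Suc n) * (zs (Suc n) k / real (Suc n))) sums e"
  proof (rule sums_has_integral[OF _ _ _ e(2)])
    fix n
    have "((\<lambda>t. real (Suc n) * (2 * sn t ^ Suc (2 * n)) * (cs t * wt t * lamp k t)) has_integral zs (Suc n) k) {0<..<1}"
      using sn_power_cs_integral[of "Suc n" k] by simp
    from has_integral_mult_right[OF has_integral_divide[OF this, of "real (Suc n)"], of "bn (Suc n)"]
    show "((\<lambda>t. bn (Suc n) * ((2 * sn t ^ Suc (2 * n)) * (cs t * wt t * lamp k t)))
       has_integral bn (Suc n) * (zs (Suc n) k / real (Suc n))) {0<..<1}"
      by (simp add: mult.assoc del: of_nat_Suc power_Suc)
  next
    fix n and t :: real assume t: "t \<in> {0<..<1}"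
    then show "0 \<le> bn (Suc n) * ((2 * sn t ^ Suc (2 * n)) * (cs t * wt t * lamp k t))"
      using bn_nonneg[of "Suc n"] sn_pos[of t] cs_pos[of t] wt_pos[of t] lamp_nonneg[of t k] by simp
  next
    fix t :: real assume "t \<in> {0<..<1}"
    then have t: "0 \<le> t" "t < 1" and s: "sn t > 0" and c: "cs t > 0" using sn_pos cs_pos by auto
    have "(\<lambda>n. bn (Suc n) * sn t ^ (2 * Suc n)) sums (1 / cs t - 1)"
      using bn_sums[OF t] sums_Suc_iff[of "\<lambda>n. bn n * sn t ^ (2 * n)"] by simp
    then have "(\<lambda>n. 2 * (cs t * wt t * lamp k t) / sn t * (bn (Suc n) * sn t ^ (2 * Suc n)))
        sums (2 * (cs t * wt t * lamp k t) / sn t * (1 / cs t - 1))"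
      by (rule sums_mult)
    moreover have "2 * (cs t * wt t * lamp k t) / sn t * (bn (Suc n) * sn t ^ (2 * Suc n))
        = bn (Suc n) * ((2 * sn t ^ Suc (2 * n)) * (cs t * wt t * lamp k t))" for n
      using s by (simp add: mult_ac)
    moreover have "2 * (cs t * wt t * lamp k t) / sn t * (1 / cs t - 1) = 2 * sn t * lamp k t"
    proof -
      have "wt t * (1 - cs t) = sn t * sn t"
        using sn_cs[of t] by (simp add: wt_eq power2_eq_square algebra_simps)
      then have eq: "wt t * lamp k t * (1 - cs t) = sn t * sn t * lamp k t" by (simp add: mult_ac)
      have "2 * (cs t * wt t * lamp k t) / sn t * (1 / cs t - 1) = 2 * (wt t * lamp k t * (1 - cs t)) / sn t"
        using c by (simp add: right_diff_distrib diff_divide_distrib mult_ac)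
      also have "\<dots> = 2 * sn t * lamp k t"
        unfolding eq using s by simp
      finally show ?thesis .
    qed
    ultimately show "(\<lambda>n. bn (Suc n) * ((2 * sn t ^ Suc (2 * n)) * (cs t * wt t * lamp k t))) sums (2 * sn t * lamp k t)"
      by (simp only:)
  qed
  then show "(\<lambda>n. bn (Suc n) * (zs (Suc n) k / real (Suc n))) sums Ev k"
    unfolding Ev_def by (simp add: sums_iff)
  from this sums have "Ev k = e" by (rule sums_unique2)
  then show "limval (Suc k) (of_real (Ev k))"
    using limval_scale[OF limval_add[OF uv], of "- 2"] e(1) by simp
qed

lemma lam_sums:
  assumes "0 \<le> t" "t < 1"
  shows "(\<lambda>n. sn t ^ (2 * Suc n) / real (Suc n)) sums lam t"
proof -
  have "(\<lambda>n. - ((- (- (sn t)\<^sup>2)) ^ n) / of_nat n) sums ln (1 + - (sn t)\<^sup>2)"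
    using sn_square_abs_less_1[OF assms] by (intro ln_series') simp
  moreover have "1 + - (sn t)\<^sup>2 = (cs t)\<^sup>2" using cs_square[of t] by simp
  moreover have "ln ((cs t)\<^sup>2) = - lam t"
    using cs_pos[OF assms] by (simp add: lam_def ln_realpow)
  ultimately have "(\<lambda>n. - (((sn t)\<^sup>2) ^ n / real n)) sums (- lam t)" by simp
  then have "(\<lambda>n. ((sn t)\<^sup>2) ^ n / real n) sums lam t" using sums_minus by fastforce
  then show ?thesis
    using sums_Suc_iff[of "\<lambda>n. ((sn t)\<^sup>2) ^ n / real n" "lam t"]
    by (simp flip: power_mult del: power_Suc of_nat_Suc)
qed

text \<open>Both sides evaluate the integral of \<lambda> times \<open>lamp j\<close>, the right one
  by expanding \<lambda> and integrating termwise. For generating functions in j it says that E is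
  the logarithmic derivative of I.\<close>

lemma Iv_Suc: "real (Suc j) * Iv (Suc j) = (\<Sum>i\<le>j. Iv i * Ev (j - i))"
proof (rule sums_unique2)
  show "(\<lambda>n. Sv (Suc n) j / real (Suc n)) sums (real (Suc j) * Iv (Suc j))"
  proof (rule sums_has_integral)
    show "((\<lambda>t. sn t ^ (2 * Suc n) * wt t * lamp j t / real (Suc n)) has_integral Sv (Suc n) j / real (Suc n)) {0<..<1}" for n
      by (intro has_integral_divide sn_power_integral)
    show "((\<lambda>t. real (Suc j) * (wt t * lamp (Suc j) t)) has_integral real (Suc j) * Iv (Suc j)) {0<..<1}"
      by (intro has_integral_mult_right Iv_integral)
    show "0 \<le> sn t ^ (2 * Suc n) * wt t * lamp j t / real (Suc n)" if "t \<in> {0<..<1}" for n t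
      using that sn_pos[of t] wt_pos[of t] lamp_nonneg[of t j] by simp
    show "(\<lambda>n. sn t ^ (2 * Suc n) * wt t * lamp j t / real (Suc n)) sums (real (Suc j) * (wt t * lamp (Suc j) t))"
      if "t \<in> {0<..<1}" for t
    proof -
      have "(\<lambda>n. sn t ^ (2 * Suc n) / real (Suc n) * (wt t * lamp j t)) sums (lam t * (wt t * lamp j t))"
        using that by (intro sums_mult2 lam_sums) auto
      moreover have "lam t * (wt t * lamp j t) = real (Suc j) * (wt t * lamp (Suc j) t)"
        using lam_times_lamp[of t j] by (metis mult.left_commute)
      ultimately show ?thesis by (simp only: times_divide_eq_left mult.assoc)
    qed
  qed
  have "(\<lambda>n. \<Sum>i\<le>j. Iv i * (bn (Suc n) * (zs (Suc n) (j - i) / real (Suc n)))) sums (\<Sum>i\<le>j. Iv i * Ev (j - i))"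
    by (intro sums_sum sums_mult Ev)
  then show "(\<lambda>n. Sv (Suc n) j / real (Suc n)) sums (\<Sum>i\<le>j. Iv i * Ev (j - i))"
    by (simp only: Sv_def sum_divide_distrib times_divide_eq_right)
qed

text \<open>The recursion is homogeneous in the I_i, so dividing by I_0 makes its starting value 1;
  apart from that, only rational division by j occurs.\<close>

lemma limval_Iv: "limval j (of_real (Iv j / (pi / 2)))"
proof (induction j rule: less_induct)
  case (less j)
  show ?case
  proof (cases j)
    case 0
    then show ?thesis by (simp add: Iv_0 limval_one)
  next
    case (Suc k)
    have "limval j (of_real (Iv i / (pi / 2)) * of_real (Ev (k - i)))" if "i \<in> {..k}" for i
    proof -
      have "i < j" "j = i + Suc (k - i)" using that Suc by auto
      with limval_mult[OF less.IH[OF \<open>i < j\<close>] Ev(2)[of "k - i"]] show ?thesis by metis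
    qed
    then have "limval j (\<Sum>i\<le>k. of_real (Iv i / (pi / 2)) * of_real (Ev (k - i)))"
      by (rule limval_sum)
    from limval_scale[OF this, of "1 / of_nat (Suc k)"]
    have "limval j (of_rat (1 / of_nat (Suc k)) * (\<Sum>i\<le>k. of_real (Iv i / (pi / 2)) * of_real (Ev (k - i))))" .
    also have "of_rat (1 / of_nat (Suc k)) = complex_of_real (1 / real (Suc k))"
      by (simp only: of_rat_divide of_rat_1 of_rat_of_nat_eq of_real_divide of_real_1 of_real_of_nat_eq)
    also have "complex_of_real (1 / real (Suc k)) * (\<Sum>i\<le>k. of_real (Iv i / (pi / 2)) * of_real (Ev (k - i)))
        = of_real (1 / real (Suc k) * ((\<Sum>i\<le>k. Iv i * Ev (k - i)) / (pi / 2)))"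
      unfolding sum_divide_distrib by (simp add: mult_ac del: of_nat_Suc)
    also have "1 / real (Suc k) * ((\<Sum>i\<le>k. Iv i * Ev (k - i)) / (pi / 2)) = Iv j / (pi / 2)"
      unfolding Iv_Suc[symmetric] Suc by (simp del: of_nat_Suc)
    finally show ?thesis .
  qed
qed

section \<open>The triangular system for the sums of the theorem\<close>

definition summand :: "nat \<Rightarrow> nat \<Rightarrow> nat \<Rightarrow> nat \<Rightarrow> real" where
  "summand d m j n = gc d n / (2 * real n + 1) ^ m * (bn n * zs n j)"

lemma summand_nonneg: "summand d m j n \<ge> 0"
  by (simp add: summand_def gc_nonneg bn_nonneg zs_nonneg)

text \<open>Since dx / sin x = dt / t, removing one sine from \<open>phi\<close> turns the integral
  against dx into one against the letter 0. The weight is 2d + 1 from the power of x, m from the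
  cotangents, j from \<lambda> and 1 from dt / t.\<close>

lemma summand_sum_integral:
  obtains X where "limval (2 * d + m + j + 2) (\<i> * of_real X)"
    "(\<lambda>n. \<Sum>i\<le>j. Iv i * summand d (Suc m) (j - i) n) sums X"
proof -
  let ?f = "phi_fps d m * lamp_fps j"
  have pl: "polylog False (2 * d + m + 1 + j) ?f"
    using polylog_mult[OF polylog_phi polylog_lamp, of d m j] by simp
  obtain v where v: "limval (Suc (2 * d + m + 1 + j)) v"
    and int: "((\<lambda>t. form 0 t * pval ?f t) has_integral v) {0<..<1}"
    using form_integral[OF pl, of 0] by auto
  have "((\<lambda>t. \<i> * complex_of_real (phi d (Suc m) t * lamp j t / t)) has_integral v) {0<..<1}"
  proof (rule has_integral_eq[OF _ int])
    fix t :: real assume "t \<in> {0<..<1}"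
    then have "pval ?f t = \<i> * of_real (phi d (Suc m) t) * of_real (lamp j t)"
      by (simp add: pval_mult[OF polylog_phi polylog_lamp] pval_phi pval_lamp)
    then show "form 0 t * pval ?f t = \<i> * complex_of_real (phi d (Suc m) t * lamp j t / t)"
      by (simp add: form_def)
  qed
  then obtain X where X: "v = \<i> * of_real X"
      "((\<lambda>t. phi d (Suc m) t * lamp j t / t) has_integral X) {0<..<1}"
    by (rule i_integral_imp_real)
  have "(\<lambda>n. gc d n / (2 * real n + 1) ^ Suc m * Sv n j) sums X"
  proof (rule sums_has_integral[OF _ _ _ X(2)])
    show "((\<lambda>t. gc d n / (2 * real n + 1) ^ Suc m * (sn t ^ (2 * n) * wt t * lamp j t)) has_integral
        gc d n / (2 * real n + 1) ^ Suc m * Sv n j) {0<..<1}" for n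
      by (intro has_integral_mult_right sn_power_integral)
    show "0 \<le> gc d n / (2 * real n + 1) ^ Suc m * (sn t ^ (2 * n) * wt t * lamp j t)" if "t \<in> {0<..<1}" for n t
      using that gc_nonneg[of d n] sn_pos[of t] wt_pos[of t] lamp_nonneg[of t j] by simp
    show "(\<lambda>n. gc d n / (2 * real n + 1) ^ Suc m * (sn t ^ (2 * n) * wt t * lamp j t)) sums
        (phi d (Suc m) t * lamp j t / t)" if "t \<in> {0<..<1}" for t
    proof -
      have t: "0 \<le> t" "t < 1" "0 < t" using that by auto
      have "(\<lambda>n. gc d n / (2 * real n + 1) ^ Suc m * ((sn t)\<^sup>2) ^ n * (wt t * lamp j t)) sums
          (eval_fps (gser d (Suc m)) ((sn t)\<^sup>2) * (wt t * lamp j t))"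
        by (intro sums_mult2 gser_sums sn_square_abs_less_1 t)
      moreover have "eval_fps (gser d (Suc m)) ((sn t)\<^sup>2) * (wt t * lamp j t) = phi d (Suc m) t * lamp j t / t"
      proof -
        have "wt t = sn t / t" using t by (simp add: wt_def sn_def)
        then show ?thesis by (simp add: phi_def)
      qed
      ultimately show ?thesis by (simp only: power_mult mult.assoc)
    qed
  qed
  moreover have "gc d n / (2 * real n + 1) ^ Suc m * Sv n j = (\<Sum>i\<le>j. Iv i * summand d (Suc m) (j - i) n)" for n
    unfolding Sv_def summand_def sum_distrib_left by (simp only: mult.left_commute)
  ultimately have "(\<lambda>n. \<Sum>i\<le>j. Iv i * summand d (Suc m) (j - i) n) sums X" by (simp only:)
  moreover have "limval (2 * d + m + j + 2) (\<i> * of_real X)" using v X(1) by simp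
  ultimately show ?thesis using that by blast
qed

text \<open>The whole combination converges and its terms are nonnegative, so the part with i = 0
  converges too, and its coefficient \<open>Iv 0\<close> is positive.\<close>

lemma summable_summand: "summable (summand d (Suc m) j)"
proof -
  obtain X where X: "(\<lambda>n. \<Sum>i\<le>j. Iv i * summand d (Suc m) (j - i) n) sums X"
    using summand_sum_integral .
  have "norm (Iv 0 * summand d (Suc m) j n) \<le> (\<Sum>i\<le>j. Iv i * summand d (Suc m) (j - i) n)" for n
    using member_le_sum[of 0 "{..j}" "\<lambda>i. Iv i * summand d (Suc m) (j - i) n"]
    by (simp add: Iv_nonneg summand_nonneg)
  then have "summable (\<lambda>n. Iv 0 * summand d (Suc m) j n)"
    by (intro summable_comparison_test[OF _ sums_summable[OF X]]) blast
  then show ?thesis by (simp add: Iv_0)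
qed

text \<open>After multiplication by 2 \<i>, the diagonal term of the system is exactly \<i>
  \<open>pi\<close> times the unknown sum, and the coefficients of the earlier such values become
  \<open>Iv i / (pi / 2)\<close>, of weight i.\<close>

lemma limval_suminf_summand:
  "limval (2 * d + m + j + 2) (\<i> * of_real (pi * suminf (summand d (Suc m) j)))"
proof (induction j rule: less_induct)
  case (less j)
  define T where "T = (\<lambda>j. suminf (summand d (Suc m) j))"
  obtain X where X: "limval (2 * d + m + j + 2) (\<i> * of_real X)"
    "(\<lambda>n. \<Sum>i\<le>j. Iv i * summand d (Suc m) (j - i) n) sums X"
    using summand_sum_integral .
  have "(\<lambda>n. \<Sum>i\<le>j. Iv i * summand d (Suc m) (j - i) n) sums (\<Sum>i\<le>j. Iv i * T (j - i))"
    unfolding T_def by (intro sums_sum sums_mult summable_sums summable_summand)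
  then have "X = (\<Sum>i\<le>j. Iv i * T (j - i))" using X(2) by (simp add: sums_unique2)
  also have "\<dots> = Iv 0 * T j + (\<Sum>i<j. Iv (Suc i) * T (j - Suc i))"
    by (simp add: sum.atMost_shift)
  finally have "pi * T j = 2 * X - (\<Sum>i<j. (Iv (Suc i) / (pi / 2)) * (pi * T (j - Suc i)))"
    by (simp add: Iv_0 sum_distrib_left sum_divide_distrib field_simps)
  then have eq: "\<i> * complex_of_real (pi * T j) = of_rat 2 * (\<i> * of_real X)
      - (\<Sum>i<j. of_real (Iv (Suc i) / (pi / 2)) * (\<i> * of_real (pi * T (j - Suc i))))"
    by (simp add: right_diff_distrib sum_distrib_left mult_ac)
  have "limval (2 * d + m + j + 2) (of_real (Iv (Suc i) / (pi / 2)) * (\<i> * of_real (pi * T (j - Suc i))))"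
    if "i \<in> {..<j}" for i
  proof -
    have "j - Suc i < j" "2 * d + m + j + 2 = Suc i + (2 * d + m + (j - Suc i) + 2)" using that by auto
    with limval_mult[OF limval_Iv[of "Suc i"] less.IH[OF \<open>j - Suc i < j\<close>]] show ?thesis
      unfolding T_def by metis
  qed
  then have "limval (2 * d + m + j + 2) (\<i> * of_real (pi * T j))"
    unfolding eq by (intro limval_diff limval_scale limval_sum X(1))
  then show ?case unfolding T_def .
qed

theorem theorem9p14:
  fixes p m k :: nat
  assumes "p \<ge> 1" and "m \<ge> 1"
  shows "let f = (\<lambda>n. (real ((2 * n) choose n) / 4 ^ n)\<^sup>2 *
                   (t_sum n (replicate (p - 1) 2) * zeta_star_sum n (replicate k 1)
                     / (2 * real n + 1) ^ m))
         in f summable_on {p - 1..} \<and>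
            complex_of_real (\<Sum>\<^sub>\<infinity>n\<in>{p - 1..}. f n)
              \<in> (\<lambda>x. \<i> / of_real pi * x) ` CMZV 4 (2 * p + k + m - 1)"
proof -
  define f where "f = (\<lambda>n. (real ((2 * n) choose n) / 4 ^ n)\<^sup>2 *
                   (t_sum n (replicate (p - 1) 2) * zeta_star_sum n (replicate k 1)
                     / (2 * real n + 1) ^ m))"
  obtain M where M: "m = Suc M" using assms(2) by (cases m) auto
  define T where "T = suminf (summand (p - 1) (Suc M) k)"
  have f: "f = summand (p - 1) (Suc M) k"
    by (rule ext) (simp add: f_def summand_def M gc_def bn_def zs_def power2_eq_square mult_ac)
  have "f sums T"
    unfolding f T_def using summable_summand by (rule summable_sums)
  then have "(f has_sum T) UNIV"
    by (rule sums_nonneg_imp_has_sum) (simp add: f summand_nonneg)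
  also have "(f has_sum T) UNIV \<longleftrightarrow> (f has_sum T) {p - 1..}"
    by (rule has_sum_cong_neutral) (auto simp: f_def t_sum_eq_0)
  finally have sum: "(f has_sum T) {p - 1..}" .
  have "limval (2 * (p - 1) + M + k + 2) (\<i> * of_real (pi * T))"
    unfolding T_def by (rule limval_suminf_summand)
  moreover have "2 * (p - 1) + M + k + 2 = 2 * p + k + m - 1" using assms M by simp
  \<comment> \<open>The sign compensates \<i>^2 = -1 when the value is multiplied by \<i> /
    pi.\<close>
  ultimately have "- (\<i> * of_real (pi * T)) \<in> CMZV 4 (2 * p + k + m - 1)"
    using limval_CMZV[OF limval_uminus] by metis
  moreover have "\<i> / of_real pi * (- (\<i> * of_real (pi * T))) = complex_of_real T"
    by simp
  ultimately have "complex_of_real T \<in> (\<lambda>x. \<i> / of_real pi * x) ` CMZV 4 (2 * p + k + m - 1)"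
    by (metis imageI)
  then show ?thesis
    using has_sum_imp_summable[OF sum] infsumI[OF sum] unfolding f_def[symmetric] Let_def by simp
qed

end
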